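(* Let $k$ be a field and $G$ a finite group. The functor $\widetilde{k_*}:\mathbf{Rep}_k(G)\to\mathbf{Mky}(G)$, $\widetilde{k_*}(R)=\mathbf{Rep}_k(G)(k_*-,R)$, is fully faithful.
   Context: $\mathcal{E}$ is the category of finite $G$-sets; $\mathbf{Rep}_k(G)$ is the category of finite-dimensional $k$-linear representations of $G$. $\mathcal{T}=\mathbf{Spn}(\mathcal{E})$ is the category whose objects are those of $\mathcal{E}$ and whose morphisms $X\to Y$ are isomorphism classes of spans $(u,S,v)$, with $u:S\to X$ and $v:S\to Y$ in $\mathcal{E}$, composed by pullback. It has finite direct sums (given by disjoint union of $G$-sets) and is enriched in commutative monoids (addition of spans by disjoint union of the objects $S$). $\mathbf{Mky}(G)$ is the category of Mackey functors on $G$, i.e. additive functors $\mathcal{T}\to\mathbf{Vect}_k$, with natural transformations as morphisms. The functor $k_*:\mathcal{T}^{\mathrm{op}}\to\mathbf{Rep}_k(G)$ sends $X$ to the permutation representation $kX$ and a span $(u,S,v):X\to Y$ to the linear map $k_*(S):kY\to kX$, $k_*(S)(y)=\sum_{v(s)=y}u(s)$. Thus $\widetilde{k_*}(R)(X)=\mathbf{Rep}_k(G)(kX,R)$ is identified with the space of $G$-maps $X\to R$, and a span $(u,S,v):X\to Y$ sends $\tau:X\to R$ to $\tau_S:Y\to R$, $\tau_S(y)=\sum_{v(s)=y}\tau(u(s))$. *)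

theory Defs
  imports "Jordan_Normal_Form.Missing_VectorSpace" "HOL-Algebra.Group_Action"
begin

section \<open>Categories and functors\<close>

text \<open>
  Hom-sets are indexed by their source and target and need not be disjoint, so operations on
  arrows take the objects as arguments: \<open>Cmp C X Y Z b a\<close> is the composite of \<open>a : X \<rightarrow> Y\<close>
  followed by \<open>b : Y \<rightarrow> Z\<close>.
\<close>

record ('o, 'a) cat =
  Obj :: "'o set"
  Hom :: "'o \<Rightarrow> 'o \<Rightarrow> 'a set"
  Ident :: "'o \<Rightarrow> 'a"
  Cmp :: "'o \<Rightarrow> 'o \<Rightarrow> 'o \<Rightarrow> 'a \<Rightarrow> 'a \<Rightarrow> 'a"

record ('o, 'a) add_cat = "('o, 'a) cat" +
  Add :: "'o \<Rightarrow> 'o \<Rightarrow> 'a \<Rightarrow> 'a \<Rightarrow> 'a"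
  Null :: "'o \<Rightarrow> 'o \<Rightarrow> 'a"

locale category =
  fixes C :: "('o, 'a, 'z) cat_scheme"
  assumes Ident_in: "X \<in> Obj C \<Longrightarrow> Ident C X \<in> Hom C X X"
    and Cmp_in: "\<lbrakk>X \<in> Obj C; Y \<in> Obj C; Z \<in> Obj C; a \<in> Hom C X Y; b \<in> Hom C Y Z\<rbrakk>
      \<Longrightarrow> Cmp C X Y Z b a \<in> Hom C X Z"
    and Cmp_Ident: "\<lbrakk>X \<in> Obj C; Y \<in> Obj C; a \<in> Hom C X Y\<rbrakk> \<Longrightarrow> Cmp C X X Y a (Ident C X) = a"
    and Ident_Cmp: "\<lbrakk>X \<in> Obj C; Y \<in> Obj C; a \<in> Hom C X Y\<rbrakk> \<Longrightarrow> Cmp C X Y Y (Ident C Y) a = a"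
    and Cmp_assoc: "\<lbrakk>W \<in> Obj C; X \<in> Obj C; Y \<in> Obj C; Z \<in> Obj C;
        a \<in> Hom C W X; b \<in> Hom C X Y; c \<in> Hom C Y Z\<rbrakk>
      \<Longrightarrow> Cmp C W Y Z c (Cmp C W X Y b a) = Cmp C W X Z (Cmp C X Y Z c b) a"

record ('o, 'a, 'p, 'b) fctr =
  fobj :: "'o \<Rightarrow> 'p"
  fmap :: "'o \<Rightarrow> 'o \<Rightarrow> 'a \<Rightarrow> 'b"

locale cat_functor = C: category C + D: category D
  for C :: "('o, 'a, 'z) cat_scheme" and D :: "('p, 'b, 'y) cat_scheme" +
  fixes F :: "('o, 'a, 'p, 'b) fctr"
  assumes fobj_in: "X \<in> Obj C \<Longrightarrow> fobj F X \<in> Obj D"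
    and fmap_in: "\<lbrakk>X \<in> Obj C; Y \<in> Obj C; a \<in> Hom C X Y\<rbrakk>
      \<Longrightarrow> fmap F X Y a \<in> Hom D (fobj F X) (fobj F Y)"
    and fmap_Ident: "X \<in> Obj C \<Longrightarrow> fmap F X X (Ident C X) = Ident D (fobj F X)"
    and fmap_Cmp: "\<lbrakk>X \<in> Obj C; Y \<in> Obj C; Z \<in> Obj C; a \<in> Hom C X Y; b \<in> Hom C Y Z\<rbrakk>
      \<Longrightarrow> fmap F X Z (Cmp C X Y Z b a)
          = Cmp D (fobj F X) (fobj F Y) (fobj F Z) (fmap F Y Z b) (fmap F X Y a)"

locale additive_functor = cat_functor C D F
  for C :: "('o, 'a, 'z) add_cat_scheme" and D :: "('p, 'b, 'y) add_cat_scheme" and F +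
  assumes fmap_Add: "\<lbrakk>X \<in> Obj C; Y \<in> Obj C; a \<in> Hom C X Y; b \<in> Hom C X Y\<rbrakk>
      \<Longrightarrow> fmap F X Y (Add C X Y a b) = Add D (fobj F X) (fobj F Y) (fmap F X Y a) (fmap F X Y b)"
    and fmap_Null: "\<lbrakk>X \<in> Obj C; Y \<in> Obj C\<rbrakk>
      \<Longrightarrow> fmap F X Y (Null C X Y) = Null D (fobj F X) (fobj F Y)"

locale fully_faithful = cat_functor C D F for C D F +
  assumes bij_Hom: "\<lbrakk>X \<in> Obj C; Y \<in> Obj C\<rbrakk>
      \<Longrightarrow> bij_betw (fmap F X Y) (Hom C X Y) (Hom D (fobj F X) (fobj F Y))"

definition nat_trans ::
  "('o, 'a, 'z) cat_scheme \<Rightarrow> ('p, 'b, 'y) cat_scheme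
    \<Rightarrow> ('o, 'a, 'p, 'b) fctr \<Rightarrow> ('o, 'a, 'p, 'b) fctr \<Rightarrow> ('o \<Rightarrow> 'b) set" where
  "nat_trans C D M N = {\<theta> \<in> extensional (Obj C).
     (\<forall>X \<in> Obj C. \<theta> X \<in> Hom D (fobj M X) (fobj N X)) \<and>
     (\<forall>X \<in> Obj C. \<forall>Y \<in> Obj C. \<forall>a \<in> Hom C X Y.
        Cmp D (fobj M X) (fobj N X) (fobj N Y) (fmap N X Y a) (\<theta> X)
        = Cmp D (fobj M X) (fobj M Y) (fobj N Y) (\<theta> Y) (fmap M X Y a))}"


section \<open>Finite \<open>G\<close>-sets and spans\<close>

record ('g, 'x) gset =
  pts :: "'x set"
  gact :: "'g \<Rightarrow> 'x \<Rightarrow> 'x"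

definition finite_gset :: "('g, 'n) monoid_scheme \<Rightarrow> ('g, 'x) gset \<Rightarrow> bool" where
  "finite_gset G X \<longleftrightarrow> group_action G (pts X) (gact X) \<and> finite (pts X)"

definition gmaps ::
  "('g, 'n) monoid_scheme \<Rightarrow> ('g, 'x) gset \<Rightarrow> ('g, 'y) gset \<Rightarrow> ('x \<Rightarrow> 'y) set" where
  "gmaps G X Y = {f \<in> pts X \<rightarrow>\<^sub>E pts Y.
     \<forall>g \<in> carrier G. \<forall>x \<in> pts X. f (gact X g x) = gact Y g (f x)}"

record ('g, 's, 'x) gspan =
  lleg :: "'s \<Rightarrow> 'x"
  apex :: "('g, 's) gset"
  rleg :: "'s \<Rightarrow> 'x"

definition spans ::
  "('g, 'n) monoid_scheme \<Rightarrow> ('g, 'x) gset \<Rightarrow> ('g, 'x) gset \<Rightarrow> ('g, 's, 'x) gspan set" where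
  "spans G X Y = {S. finite_gset G (apex S)
     \<and> lleg S \<in> gmaps G (apex S) X \<and> rleg S \<in> gmaps G (apex S) Y}"

definition span_iso ::
  "('g, 'n) monoid_scheme \<Rightarrow> ('g, 's, 'x) gspan \<Rightarrow> ('g, 't, 'x) gspan \<Rightarrow> bool" where
  "span_iso G S T \<longleftrightarrow> (\<exists>f \<in> gmaps G (apex S) (apex T).
     bij_betw f (pts (apex S)) (pts (apex T)) \<and>
     (\<forall>s \<in> pts (apex S). lleg T (f s) = lleg S s \<and> rleg T (f s) = rleg S s))"

text \<open>
  Points of objects and apexes are taken from one type \<open>'x\<close>, and a pullback or disjoint union of
  apexes lives in \<open>'x \<times> 'x\<close> or \<open>'x + 'x\<close>.  \<open>span_class\<close> is therefore defined for a representative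
  over any type \<open>'s\<close>: it consists of the spans over \<open>'x\<close> isomorphic to it.  If \<open>'x\<close> is infinite,
  every finite \<open>G\<close>-set is isomorphic to one over \<open>'x\<close>, so these classes are never empty.
\<close>

definition span_class ::
  "('g, 'n) monoid_scheme \<Rightarrow> ('g, 'x) gset \<Rightarrow> ('g, 'x) gset \<Rightarrow> ('g, 's, 'x) gspan
    \<Rightarrow> ('g, 'x, 'x) gspan set" where
  "span_class G X Y S = {T \<in> spans G X Y. span_iso G T S}"

definition id_span :: "('g, 'x) gset \<Rightarrow> ('g, 'x, 'x) gspan" where
  "id_span X = \<lparr>lleg = (\<lambda>x \<in> pts X. x), apex = X, rleg = (\<lambda>x \<in> pts X. x)\<rparr>"

definition pullback_span ::
  "('g, 's, 'x) gspan \<Rightarrow> ('g, 't, 'x) gspan \<Rightarrow> ('g, 's \<times> 't, 'x) gspan" where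
  "pullback_span S T =
    (let P = {(s, t). s \<in> pts (apex S) \<and> t \<in> pts (apex T) \<and> rleg S s = lleg T t} in
     \<lparr>lleg = (\<lambda>p \<in> P. lleg S (fst p)),
      apex = \<lparr>pts = P, gact = (\<lambda>g. \<lambda>p \<in> P. map_prod (gact (apex S) g) (gact (apex T) g) p)\<rparr>,
      rleg = (\<lambda>p \<in> P. rleg T (snd p))\<rparr>)"

definition sum_span ::
  "('g, 's, 'x) gspan \<Rightarrow> ('g, 't, 'x) gspan \<Rightarrow> ('g, 's + 't, 'x) gspan" where
  "sum_span S T =
    (let P = pts (apex S) <+> pts (apex T) in
     \<lparr>lleg = (\<lambda>p \<in> P. case_sum (lleg S) (lleg T) p),
      apex = \<lparr>pts = P, gact = (\<lambda>g. \<lambda>p \<in> P. map_sum (gact (apex S) g) (gact (apex T) g) p)\<rparr>,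
      rleg = (\<lambda>p \<in> P. case_sum (rleg S) (rleg T) p)\<rparr>)"

definition Spn ::
  "('g, 'n) monoid_scheme \<Rightarrow> (('g, 'x) gset, ('g, 'x, 'x) gspan set) add_cat" where
  "Spn G = \<lparr>
     Obj = {X. finite_gset G X},
     Hom = (\<lambda>X Y. spans G X Y // {(S, T) \<in> spans G X Y \<times> spans G X Y. span_iso G S T}),
     Ident = (\<lambda>X. span_class G X X (id_span X)),
     Cmp = (\<lambda>X Y Z B A. \<Union>S \<in> A. \<Union>T \<in> B. span_class G X Z (pullback_span S T)),
     Add = (\<lambda>X Y A B. \<Union>S \<in> A. \<Union>T \<in> B. span_class G X Y (sum_span S T)),
     Null = (\<lambda>X Y. {S \<in> spans G X Y. pts (apex S) = {}})\<rparr>"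


section \<open>Vector spaces and Mackey functors\<close>

definition linear_maps ::
  "('k, 'm) ring_scheme \<Rightarrow> ('k, 'v) module \<Rightarrow> ('k, 'w) module \<Rightarrow> ('v \<Rightarrow> 'w) set" where
  "linear_maps K V W = module_hom K V W \<inter> extensional (carrier V)"

definition Vect :: "('k, 'm) ring_scheme \<Rightarrow> (('k, 'v) module, 'v \<Rightarrow> 'v) add_cat" where
  "Vect K = \<lparr>
     Obj = {V. vectorspace K V},
     Hom = linear_maps K,
     Ident = (\<lambda>V. \<lambda>v \<in> carrier V. v),
     Cmp = (\<lambda>U V W f e. compose (carrier U) f e),
     Add = (\<lambda>V W e f. \<lambda>v \<in> carrier V. e v \<oplus>\<^bsub>W\<^esub> f v),
     Null = (\<lambda>V W. \<lambda>v \<in> carrier V. \<zero>\<^bsub>W\<^esub>)\<rparr>"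

type_synonym ('g, 'k, 'x, 'w) mackey =
  "(('g, 'x) gset, ('g, 'x, 'x) gspan set, ('k, 'w) module, 'w \<Rightarrow> 'w) fctr"

definition Mky ::
  "('k, 'm) ring_scheme \<Rightarrow> ('g, 'n) monoid_scheme
    \<Rightarrow> (('g, 'k, 'x, 'w) mackey, ('g, 'x) gset \<Rightarrow> 'w \<Rightarrow> 'w) cat" where
  "Mky K G = \<lparr>
     Obj = {M. additive_functor (Spn G) (Vect K) M},
     Hom = nat_trans (Spn G) (Vect K),
     Ident = (\<lambda>M. \<lambda>X \<in> Obj (Spn G). Ident (Vect K) (fobj M X)),
     Cmp = (\<lambda>L M N \<phi> \<theta>. \<lambda>X \<in> Obj (Spn G).
       Cmp (Vect K) (fobj L X) (fobj M X) (fobj N X) (\<phi> X) (\<theta> X))\<rparr>"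


section \<open>Representations\<close>

record ('g, 'k, 'v) rep =
  space :: "('k, 'v) module"
  ract :: "'g \<Rightarrow> 'v \<Rightarrow> 'v"

definition representation ::
  "('k, 'm) ring_scheme \<Rightarrow> ('g, 'n) monoid_scheme \<Rightarrow> ('g, 'k, 'v) rep \<Rightarrow> bool" where
  "representation K G R \<longleftrightarrow>
     vectorspace K (space R) \<and> vectorspace.fin_dim K (space R) \<and>
     group_action G (carrier (space R)) (ract R) \<and>
     (\<forall>g \<in> carrier G. ract R g \<in> linear_maps K (space R) (space R))"

definition rep_hom ::
  "('k, 'm) ring_scheme \<Rightarrow> ('g, 'n) monoid_scheme \<Rightarrow> ('g, 'k, 'v) rep \<Rightarrow> ('g, 'k, 'w) rep
    \<Rightarrow> ('v \<Rightarrow> 'w) set" where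
  "rep_hom K G Q R = {f \<in> linear_maps K (space Q) (space R).
     \<forall>g \<in> carrier G. \<forall>v \<in> carrier (space Q). f (ract Q g v) = ract R g (f v)}"

definition Rep ::
  "('k, 'm) ring_scheme \<Rightarrow> ('g, 'n) monoid_scheme \<Rightarrow> (('g, 'k, 'v) rep, 'v \<Rightarrow> 'v) cat" where
  "Rep K G = \<lparr>
     Obj = {R. representation K G R},
     Hom = rep_hom K G,
     Ident = (\<lambda>R. \<lambda>v \<in> carrier (space R). v),
     Cmp = (\<lambda>P Q R f e. compose (carrier (space P)) f e)\<rparr>"

definition hom_space ::
  "('k, 'm) ring_scheme \<Rightarrow> ('g, 'n) monoid_scheme \<Rightarrow> ('g, 'k, 'v) rep \<Rightarrow> ('g, 'k, 'w) rep
    \<Rightarrow> ('k, 'v \<Rightarrow> 'w) module" where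
  "hom_space K G Q R = \<lparr>
     carrier = rep_hom K G Q R,
     mult = undefined, \<comment> \<open>the multiplicative fields of a module record carry no meaning\<close>
     one = undefined,
     zero = (\<lambda>v \<in> carrier (space Q). \<zero>\<^bsub>space R\<^esub>),
     add = (\<lambda>e f. \<lambda>v \<in> carrier (space Q). e v \<oplus>\<^bsub>space R\<^esub> f v),
     smult = (\<lambda>c f. \<lambda>v \<in> carrier (space Q). c \<odot>\<^bsub>space R\<^esub> f v)\<rparr>"


section \<open>The functors \<open>k\<^sub>*\<close> and \<open>R \<mapsto> Rep(k\<^sub>*-, R)\<close>\<close>

text \<open>
  The permutation representation \<open>kX\<close> is realised on the functions \<open>pts X \<rightarrow> carrier K\<close>; the point
  \<open>x\<close> corresponds to \<open>basis_vec K X x\<close>, and \<open>g\<close> sends \<open>basis_vec K X x\<close> to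
  \<open>basis_vec K X (gact X g x)\<close>.
\<close>

definition perm_rep ::
  "('k, 'm) ring_scheme \<Rightarrow> ('g, 'n) monoid_scheme \<Rightarrow> ('g, 'x) gset \<Rightarrow> ('g, 'k, 'x \<Rightarrow> 'k) rep" where
  "perm_rep K G X = \<lparr>
     space = ring.func_space K (pts X),
     ract = (\<lambda>g. \<lambda>a \<in> carrier (ring.func_space K (pts X)). \<lambda>x \<in> pts X. a (gact X (inv\<^bsub>G\<^esub> g) x))\<rparr>"

definition basis_vec :: "('k, 'm) ring_scheme \<Rightarrow> ('g, 'x) gset \<Rightarrow> 'x \<Rightarrow> 'x \<Rightarrow> 'k" where
  "basis_vec K X x = (\<lambda>x' \<in> pts X. if x' = x then \<one>\<^bsub>K\<^esub> else \<zero>\<^bsub>K\<^esub>)"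

text \<open>
  A span \<open>S : X \<rightarrow> Y\<close> induces the linear map \<open>kY \<rightarrow> kX\<close> with
  \<open>y \<mapsto> \<Sum>s | rleg S s = y. lleg S s\<close> on basis vectors.
\<close>

definition perm_span_map ::
  "('k, 'm) ring_scheme \<Rightarrow> ('g, 'x) gset \<Rightarrow> ('g, 'x) gset \<Rightarrow> ('g, 's, 'x) gspan
    \<Rightarrow> ('x \<Rightarrow> 'k) \<Rightarrow> 'x \<Rightarrow> 'k" where
  "perm_span_map K X Y S =
    (let kX = ring.func_space K (pts X); kY = ring.func_space K (pts Y) in
     (\<lambda>a \<in> carrier kY. \<Oplus>\<^bsub>kX\<^esub>y \<in> pts Y. a y \<odot>\<^bsub>kX\<^esub>
       (\<Oplus>\<^bsub>kX\<^esub>s \<in> {s \<in> pts (apex S). rleg S s = y}. basis_vec K X (lleg S s))))"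

text \<open>The map depends only on the isomorphism class of the span.\<close>

definition perm_map ::
  "('k, 'm) ring_scheme \<Rightarrow> ('g, 'x) gset \<Rightarrow> ('g, 'x) gset \<Rightarrow> ('g, 'x, 'x) gspan set
    \<Rightarrow> ('x \<Rightarrow> 'k) \<Rightarrow> 'x \<Rightarrow> 'k" where
  "perm_map K X Y A = perm_span_map K X Y (SOME S. S \<in> A)"

definition ktilde_obj ::
  "('k, 'm) ring_scheme \<Rightarrow> ('g, 'n) monoid_scheme \<Rightarrow> ('g, 'k, 'v) rep
    \<Rightarrow> ('g, 'k, 'x, ('x \<Rightarrow> 'k) \<Rightarrow> 'v) mackey" where
  "ktilde_obj K G R = \<lparr>
     fobj = (\<lambda>X. hom_space K G (perm_rep K G X) R),
     fmap = (\<lambda>X Y A. \<lambda>\<phi> \<in> rep_hom K G (perm_rep K G X) R.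
       compose (carrier (space (perm_rep K G Y))) \<phi> (perm_map K X Y A))\<rparr>"

definition ktilde ::
  "('k, 'm) ring_scheme \<Rightarrow> ('g, 'n) monoid_scheme
    \<Rightarrow> (('g, 'k, 'v) rep, 'v \<Rightarrow> 'v, ('g, 'k, 'x, ('x \<Rightarrow> 'k) \<Rightarrow> 'v) mackey,
        ('g, 'x) gset \<Rightarrow> (('x \<Rightarrow> 'k) \<Rightarrow> 'v) \<Rightarrow> ('x \<Rightarrow> 'k) \<Rightarrow> 'v) fctr" where
  "ktilde K G = \<lparr>
     fobj = ktilde_obj K G,
     fmap = (\<lambda>Q R f. \<lambda>X \<in> Obj (Spn G). \<lambda>\<phi> \<in> rep_hom K G (perm_rep K G X) Q.
       compose (carrier (space (perm_rep K G X))) f \<phi>)\<rparr>"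

end

(*
  Write k\<Gamma> for the permutation representation of \<Gamma> = G with left translation and e for its base point.
  Evaluation at the basis vector e identifies G-maps k\<Gamma> \<rightarrow> Q with vectors of Q, so a natural
  transformation \<theta> from Rep(k_*-, Q) to Rep(k_*-, R) yields a function f : Q \<rightarrow> R by evaluating
  \<theta>_\<Gamma> (q) at e.  A point x of a G-set X gives the span X \<leftarrow> \<Gamma> = \<Gamma> whose left leg is the orbit map
  of x; it sends e to x under k_*, so naturality of \<theta> along it says \<theta>_X(\<psi>)(x) = f(\<psi>(x)).  Hence
  f determines \<theta>, and the equivariance of f is the case X = \<Gamma>.

  Composition of spans is computed from the formula (S_* a)(x) = \<Sum> (a (r s)) over the s with l s = x,
  where l and r are the legs of S.
*)
theory Submission
  imports Defs
begin

section \<open>Finite \<open>G\<close>-sets\<close>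

text \<open>The spans of \<open>Spn\<close> have apexes in one type \<open>'x\<close>, while a
  pullback lives in \<open>'x \<times> 'x\<close> and a disjoint union in \<open>'x + 'x\<close>.
  Constructions on spans are therefore treated for apexes of arbitrary type, and a finite apex is
  copied back into \<open>'x\<close> only to see that its class is nonempty and is an arrow. This is
  one use of the infinitude of \<open>'x\<close>; the other is that \<open>'x\<close> contains a
  copy of \<open>G\<close>, which makes \<Gamma> an object.

  The definition of \<open>perm_span_map\<close> adds basis vectors over the fibres of the right
  leg. Its coordinate at \<open>x\<close> is a sum of scalars over the fibre of the left leg, and in
  that form every identity about spans becomes a matching of finite fibres.

  The linearity of f has its own reason. Evaluation at e is a linear bijection from the G-maps
  k\<Gamma> \<rightarrow> Q onto Q, so its inverse is linear, and f is this inverse followed by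
  \<theta> at \<Gamma> and by evaluation at e again. For equivariance, g v is the value at g e of
  the G-map that belongs to v.\<close>

lemma exists_inj_on_infinite:
  assumes "infinite (UNIV :: 'x set)" and "finite A"
  shows "\<exists>h :: 's \<Rightarrow> 'x. inj_on h A"
proof -
  obtain B :: "'x set" where "finite B" "card B = card A"
    using infinite_arbitrarily_large[OF assms(1)] by blast
  with assms(2) obtain h where "bij_betw h A B"
    by (metis finite_same_card_bij)
  then show ?thesis by (auto simp: bij_betw_def)
qed

context group
begin

text \<open>\<open>group_action\<close> is a homomorphism into \<open>BijGroup\<close>, which asks
  for bijections that are extensional. The pointwise laws suffice: the action of
  \<open>inv g\<close> is a two-sided inverse of that of \<open>g\<close>, and extensionality turns
  pointwise agreement into equality in \<open>BijGroup\<close>.\<close>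

lemma finite_gsetI:
  assumes "finite (pts X)"
    and "\<And>g. g \<in> carrier G \<Longrightarrow> gact X g \<in> extensional (pts X)"
    and closed: "\<And>g x. g \<in> carrier G \<Longrightarrow> x \<in> pts X \<Longrightarrow> gact X g x \<in> pts X"
    and one: "\<And>x. x \<in> pts X \<Longrightarrow> gact X \<one> x = x"
    and mult: "\<And>g h x. g \<in> carrier G \<Longrightarrow> h \<in> carrier G \<Longrightarrow> x \<in> pts X
      \<Longrightarrow> gact X (g \<otimes> h) x = gact X g (gact X h x)"
  shows "finite_gset G X"
proof -
  have inverse: "gact X (inv g) (gact X g x) = x" "gact X g (gact X (inv g) x) = x"
    if "g \<in> carrier G" "x \<in> pts X" for g x
    using that mult[of "inv g" g x] mult[of g "inv g" x] one by simp_all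
  have bij: "gact X g \<in> Bij (pts X)" if "g \<in> carrier G" for g
    using assms(2) that closed inverse
    by (auto simp: Bij_def intro!: bij_betw_byWitness[where f' = "gact X (inv g)"])
  have "gact X \<in> hom G (BijGroup (pts X))"
    using bij assms(2) mult
    by (auto simp: hom_def BijGroup_def compose_def intro!: extensionalityI[of _ "pts X"])
  then have "group_hom G (BijGroup (pts X)) (gact X)"
    by (simp add: group_hom_def group_hom_axioms_def group_BijGroup is_group)
  with assms(1) show ?thesis by (simp add: finite_gset_def group_action_def)
qed

lemma gact_closed [simp]:
  "finite_gset G X \<Longrightarrow> g \<in> carrier G \<Longrightarrow> x \<in> pts X \<Longrightarrow> gact X g x \<in> pts X"
  by (auto simp: finite_gset_def intro: group_action.element_image)

lemma gact_one [simp]: "finite_gset G X \<Longrightarrow> x \<in> pts X \<Longrightarrow> gact X \<one> x = x"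
  by (metis finite_gset_def group_action.id_eq_one restrict_apply')

lemma gact_mult:
  "finite_gset G X \<Longrightarrow> g \<in> carrier G \<Longrightarrow> h \<in> carrier G \<Longrightarrow> x \<in> pts X
    \<Longrightarrow> gact X (g \<otimes> h) x = gact X g (gact X h x)"
  by (auto simp: finite_gset_def intro: group_action.composition_rule)

lemma gact_inv [simp]:
  assumes "finite_gset G X" "g \<in> carrier G" "x \<in> pts X"
  shows "gact X (inv g) (gact X g x) = x" "gact X g (gact X (inv g) x) = x"
  using assms gact_mult[of X "inv g" g x] gact_mult[of X g "inv g" x] by simp_all

lemma finite_pts: "finite_gset G X \<Longrightarrow> finite (pts X)"
  by (simp add: finite_gset_def)

text \<open>Transport of structure along \<open>h\<close>: the action is conjugated by
  \<open>h\<close>. It serves to copy apexes, and later \<open>G\<close> itself, into another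
  type.\<close>

definition transport_gset :: "('s \<Rightarrow> 'x) \<Rightarrow> ('a, 's) gset \<Rightarrow> ('a, 'x) gset" where
  "transport_gset h X = \<lparr>pts = h ` pts X,
     gact = (\<lambda>g. \<lambda>z \<in> h ` pts X. h (gact X g (inv_into (pts X) h z)))\<rparr>"

lemma transport_gset:
  assumes "finite_gset G X" and "inj_on h (pts X)"
  shows "finite_gset G (transport_gset h X)"
  using assms by (intro finite_gsetI) (auto simp: transport_gset_def finite_pts gact_mult inj_on_eq_iff[OF assms(2)])

lemma gmapsI:
  assumes "f \<in> extensional (pts X)" and "\<And>x. x \<in> pts X \<Longrightarrow> f x \<in> pts Y"
    and "\<And>g x. g \<in> carrier G \<Longrightarrow> x \<in> pts X \<Longrightarrow> f (gact X g x) = gact Y g (f x)"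
  shows "f \<in> gmaps G X Y"
  using assms by (auto simp: gmaps_def PiE_def)

lemma gmaps_closed: "f \<in> gmaps G X Y \<Longrightarrow> x \<in> pts X \<Longrightarrow> f x \<in> pts Y"
  by (auto simp: gmaps_def)

lemma gmaps_equivariant:
  "f \<in> gmaps G X Y \<Longrightarrow> g \<in> carrier G \<Longrightarrow> x \<in> pts X \<Longrightarrow> f (gact X g x) = gact Y g (f x)"
  by (auto simp: gmaps_def)

section \<open>Spans\<close>

lemma spans_apex: "S \<in> spans G X Y \<Longrightarrow> finite_gset G (apex S)"
  by (simp add: spans_def)

lemma spans_finite: "S \<in> spans G X Y \<Longrightarrow> finite (pts (apex S))"
  by (simp add: spans_def finite_gset_def)

lemma spans_lleg [simp]:
  "S \<in> spans G X Y \<Longrightarrow> s \<in> pts (apex S) \<Longrightarrow> lleg S s \<in> pts X"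
  "S \<in> spans G X Y \<Longrightarrow> g \<in> carrier G \<Longrightarrow> s \<in> pts (apex S)
    \<Longrightarrow> lleg S (gact (apex S) g s) = gact X g (lleg S s)"
  by (auto simp: spans_def gmaps_equivariant intro: gmaps_closed)

lemma spans_rleg [simp]:
  "S \<in> spans G X Y \<Longrightarrow> s \<in> pts (apex S) \<Longrightarrow> rleg S s \<in> pts Y"
  "S \<in> spans G X Y \<Longrightarrow> g \<in> carrier G \<Longrightarrow> s \<in> pts (apex S)
    \<Longrightarrow> rleg S (gact (apex S) g s) = gact Y g (rleg S s)"
  by (auto simp: spans_def gmaps_equivariant intro: gmaps_closed)

lemma spans_gact [simp]:
  "S \<in> spans G X Y \<Longrightarrow> g \<in> carrier G \<Longrightarrow> s \<in> pts (apex S) \<Longrightarrow> gact (apex S) g s \<in> pts (apex S)"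
  by (simp add: spans_apex)

text \<open>Restricting \<open>f\<close> to the apex provides the extensional map that
  \<open>gmaps\<close> demands, so that ordinary functions such as \<open>fst\<close>,
  \<open>snd\<close> and \<open>map_prod\<close> can serve as witnesses.\<close>

lemma span_isoI:
  assumes "S \<in> spans G X Y"
    and "bij_betw f (pts (apex S)) (pts (apex T))"
    and "\<And>g s. g \<in> carrier G \<Longrightarrow> s \<in> pts (apex S)
      \<Longrightarrow> f (gact (apex S) g s) = gact (apex T) g (f s)"
    and "\<And>s. s \<in> pts (apex S) \<Longrightarrow> lleg T (f s) = lleg S s"
    and "\<And>s. s \<in> pts (apex S) \<Longrightarrow> rleg T (f s) = rleg S s"
  shows "span_iso G S T"
  unfolding span_iso_def
proof (intro bexI conjI ballI)
  let ?f = "restrict f (pts (apex S))"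
  show "?f \<in> gmaps G (apex S) (apex T)"
    using assms by (intro gmapsI) (auto simp: bij_betwE)
  show "bij_betw ?f (pts (apex S)) (pts (apex T))"
    using assms(2) by (simp cong: bij_betw_cong)
qed (use assms in simp_all)

lemma span_isoE:
  assumes "span_iso G S T"
  obtains f where "bij_betw f (pts (apex S)) (pts (apex T))"
    and "\<And>s. s \<in> pts (apex S) \<Longrightarrow> f s \<in> pts (apex T)"
    and "\<And>g s. g \<in> carrier G \<Longrightarrow> s \<in> pts (apex S)
      \<Longrightarrow> f (gact (apex S) g s) = gact (apex T) g (f s)"
    and "\<And>s. s \<in> pts (apex S) \<Longrightarrow> lleg T (f s) = lleg S s"
    and "\<And>s. s \<in> pts (apex S) \<Longrightarrow> rleg T (f s) = rleg S s"
  using assms by (auto simp: span_iso_def gmaps_equivariant bij_betwE)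

lemma span_iso_refl: "S \<in> spans G X Y \<Longrightarrow> span_iso G S S"
  by (rule span_isoI[where f = "\<lambda>s. s"]) (auto simp: bij_betw_def)

lemma span_iso_sym:
  assumes S: "S \<in> spans G X Y" and T: "T \<in> spans G X Y" and "span_iso G S T"
  shows "span_iso G T S"
proof -
  obtain f where bij: "bij_betw f (pts (apex S)) (pts (apex T))"
    and act: "\<And>g s. g \<in> carrier G \<Longrightarrow> s \<in> pts (apex S)
      \<Longrightarrow> f (gact (apex S) g s) = gact (apex T) g (f s)"
    and legs: "\<And>s. s \<in> pts (apex S) \<Longrightarrow> lleg T (f s) = lleg S s"
      "\<And>s. s \<in> pts (apex S) \<Longrightarrow> rleg T (f s) = rleg S s"
    using span_isoE[OF assms(3)] by metis
  let ?h = "inv_into (pts (apex S)) f"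
  have h: "?h t \<in> pts (apex S)" "f (?h t) = t" if "t \<in> pts (apex T)" for t
    using bij that by (auto simp: bij_betw_def inv_into_into f_inv_into_f)
  show ?thesis
  proof (rule span_isoI[OF T bij_betw_inv_into[OF bij]])
    fix g t assume g: "g \<in> carrier G" and t: "t \<in> pts (apex T)"
    \<comment> \<open>With \<open>t\<close> written as the image of its preimage, the action on
      \<open>T\<close> becomes \<open>f\<close> of the action on \<open>S\<close>, and injectivity
      of \<open>f\<close> cancels it.\<close>
    have "gact (apex T) g t = f (gact (apex S) g (?h t))"
      using act[OF g h(1)[OF t]] h(2)[OF t] by simp
    then show "?h (gact (apex T) g t) = gact (apex S) g (?h t)"
      using bij S g h(1)[OF t] by (simp add: bij_betw_def)
  next
    fix t assume t: "t \<in> pts (apex T)"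
    show "lleg S (?h t) = lleg T t" "rleg S (?h t) = rleg T t"
      using legs[OF h(1)[OF t]] h(2)[OF t] by simp_all
  qed
qed

lemma span_iso_trans:
  assumes S: "S \<in> spans G X Y" and "span_iso G S T" and "span_iso G T U"
  shows "span_iso G S U"
proof -
  obtain f where f: "bij_betw f (pts (apex S)) (pts (apex T))"
    "\<And>s. s \<in> pts (apex S) \<Longrightarrow> f s \<in> pts (apex T)"
    "\<And>g s. g \<in> carrier G \<Longrightarrow> s \<in> pts (apex S)
      \<Longrightarrow> f (gact (apex S) g s) = gact (apex T) g (f s)"
    "\<And>s. s \<in> pts (apex S) \<Longrightarrow> lleg T (f s) = lleg S s"
    "\<And>s. s \<in> pts (apex S) \<Longrightarrow> rleg T (f s) = rleg S s"
    using span_isoE[OF assms(2)] by metis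
  obtain h where h: "bij_betw h (pts (apex T)) (pts (apex U))"
    "\<And>s. s \<in> pts (apex T) \<Longrightarrow> h s \<in> pts (apex U)"
    "\<And>g s. g \<in> carrier G \<Longrightarrow> s \<in> pts (apex T)
      \<Longrightarrow> h (gact (apex T) g s) = gact (apex U) g (h s)"
    "\<And>s. s \<in> pts (apex T) \<Longrightarrow> lleg U (h s) = lleg T s"
    "\<And>s. s \<in> pts (apex T) \<Longrightarrow> rleg U (h s) = rleg T s"
    using span_isoE[OF assms(3)] by metis
  show ?thesis
    by (rule span_isoI[OF S bij_betw_trans[OF f(1) h(1)]]) (use f h in simp_all)
qed

text \<open>A finite apex injects into the infinite type \<open>'x\<close>; transporting the action
  and composing the legs with the inverse of the injection gives an isomorphic span there.\<close>

lemma exists_span_rep: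
  fixes S :: "('a, 's, 'x) gspan"
  assumes "infinite (UNIV :: 'x set)" and S: "S \<in> spans G X Y"
  obtains T :: "('a, 'x, 'x) gspan" where "T \<in> spans G X Y" and "span_iso G T S"
proof -
  obtain h :: "'s \<Rightarrow> 'x" where h: "inj_on h (pts (apex S))"
    using exists_inj_on_infinite[OF assms(1) spans_finite[OF S]] by blast
  let ?P = "pts (apex S)"
  define T where "T = \<lparr>lleg = (\<lambda>z \<in> h ` ?P. lleg S (inv_into ?P h z)),
    apex = transport_gset h (apex S), rleg = (\<lambda>z \<in> h ` ?P. rleg S (inv_into ?P h z))\<rparr>"
  have apex: "pts (apex T) = h ` ?P" by (simp add: T_def transport_gset_def)
  have T: "T \<in> spans G X Y"
    using S h transport_gset[OF spans_apex[OF S] h]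
    by (auto simp: T_def spans_def transport_gset_def inj_on_eq_iff[OF h] gmaps_equivariant
        intro!: gmapsI intro: gmaps_closed)
  moreover have "span_iso G S T"
    by (rule span_isoI[OF S, where f = h])
      (use S h in \<open>auto simp: T_def transport_gset_def bij_betw_def\<close>)
  ultimately show thesis using that span_iso_sym[OF S T] by blast
qed

text \<open>The apexes of \<open>S\<close> and \<open>T\<close> may have different types. This is
  what allows a pullback or a sum to be compared with a span over \<open>'x\<close>, and two
  bracketings of a triple pullback with each other.\<close>

lemma span_class_eqI:
  assumes S: "S \<in> spans G X Y" and T: "T \<in> spans G X Y" and ST: "span_iso G S T"
  shows "span_class G X Y S = span_class G X Y T"
  using span_iso_trans[OF _ _ ST] span_iso_trans[OF _ _ span_iso_sym[OF S T ST]]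
  by (auto simp: span_class_def)

lemma span_class_nonempty:
  fixes S :: "('a, 's, 'x) gspan"
  assumes "infinite (UNIV :: 'x set)" and "S \<in> spans G X Y"
  shows "span_class G X Y S \<noteq> {}"
  using exists_span_rep[OF assms] by (fastforce simp: span_class_def)

text \<open>By symmetry of \<open>span_iso\<close> the equivalence class of \<open>S\<close> is
  \<open>span_class G X Y S\<close>, the form in which all operations on arrows are computed
  below.\<close>

lemma Hom_Spn:
  fixes X Y :: "('a, 'x) gset"
  shows "Hom (Spn G) X Y = span_class G X Y ` (spans G X Y :: ('a, 'x, 'x) gspan set)"
proof -
  have "{(S, T) \<in> spans G X Y \<times> spans G X Y. span_iso G S T} `` {S} = span_class G X Y S"
    if "S \<in> spans G X Y" for S :: "('a, 'x, 'x) gspan"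
    using that by (auto simp: span_class_def intro: span_iso_sym)
  then show ?thesis by (auto simp: Spn_def quotient_def)
qed

lemma Hom_SpnE:
  fixes X Y :: "('a, 'x) gset"
  assumes "A \<in> Hom (Spn G) X Y"
  obtains S :: "('a, 'x, 'x) gspan" where "S \<in> spans G X Y" and "A = span_class G X Y S"
  using assms unfolding Hom_Spn by blast

text \<open>The class of a span over a foreign apex type is also the class of its copy over
  \<open>'x\<close>, and the latter is visibly an arrow.\<close>

lemma span_class_in_Hom:
  fixes S :: "('a, 's, 'x) gspan"
  assumes "infinite (UNIV :: 'x set)" and S: "S \<in> spans G X Y"
  shows "span_class G X Y S \<in> Hom (Spn G) X Y"
  using exists_span_rep[OF assms] span_class_eqI[OF _ S] by (metis Hom_Spn imageI)

section \<open>Composition of spans by pullback\<close>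

lemma pullback_span_simps:
  "pts (apex (pullback_span S T))
    = {(s, t). s \<in> pts (apex S) \<and> t \<in> pts (apex T) \<and> rleg S s = lleg T t}"
  "s \<in> pts (apex S) \<Longrightarrow> t \<in> pts (apex T) \<Longrightarrow> rleg S s = lleg T t
    \<Longrightarrow> gact (apex (pullback_span S T)) g (s, t) = (gact (apex S) g s, gact (apex T) g t)"
  "s \<in> pts (apex S) \<Longrightarrow> t \<in> pts (apex T) \<Longrightarrow> rleg S s = lleg T t
    \<Longrightarrow> lleg (pullback_span S T) (s, t) = lleg S s"
  "s \<in> pts (apex S) \<Longrightarrow> t \<in> pts (apex T) \<Longrightarrow> rleg S s = lleg T t
    \<Longrightarrow> rleg (pullback_span S T) (s, t) = rleg T t"
  by (simp_all add: pullback_span_def Let_def)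

lemma pullback_span_extensional:
  "gact (apex (pullback_span S T)) g \<in> extensional (pts (apex (pullback_span S T)))"
  "lleg (pullback_span S T) \<in> extensional (pts (apex (pullback_span S T)))"
  "rleg (pullback_span S T) \<in> extensional (pts (apex (pullback_span S T)))"
  by (simp_all add: pullback_span_def Let_def)

lemma pullback_span_in_spans:
  assumes S: "S \<in> spans G X Y" and T: "T \<in> spans G Y Z"
  shows "pullback_span S T \<in> spans G X Z"
  unfolding spans_def
proof (intro CollectI conjI)
  have "finite (pts (apex S) \<times> pts (apex T))"
    using spans_finite[OF S] spans_finite[OF T] by simp
  then have "finite (pts (apex (pullback_span S T)))"
    by (rule rev_finite_subset) (auto simp: pullback_span_simps)
  then show "finite_gset G (apex (pullback_span S T))"
    using S T spans_apex[OF S] spans_apex[OF T]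
    by (intro finite_gsetI pullback_span_extensional)
      (auto simp: pullback_span_simps gact_mult)
  show "lleg (pullback_span S T) \<in> gmaps G (apex (pullback_span S T)) X"
    "rleg (pullback_span S T) \<in> gmaps G (apex (pullback_span S T)) Z"
    using S T by (auto intro!: gmapsI pullback_span_extensional simp: pullback_span_simps)
qed

text \<open>The two isomorphisms preserve the legs that meet over \<open>Y\<close>, so their product
  carries the matching condition over in both directions.\<close>

lemma pullback_span_iso:
  assumes S: "S \<in> spans G X Y" and T: "T \<in> spans G Y Z"
    and "span_iso G S S'" and "span_iso G T T'"
  shows "span_iso G (pullback_span S T) (pullback_span S' T')"
proof -
  obtain f where f: "bij_betw f (pts (apex S)) (pts (apex S'))"
    "\<And>s. s \<in> pts (apex S) \<Longrightarrow> f s \<in> pts (apex S')"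
    "\<And>g s. g \<in> carrier G \<Longrightarrow> s \<in> pts (apex S)
      \<Longrightarrow> f (gact (apex S) g s) = gact (apex S') g (f s)"
    "\<And>s. s \<in> pts (apex S) \<Longrightarrow> lleg S' (f s) = lleg S s"
    "\<And>s. s \<in> pts (apex S) \<Longrightarrow> rleg S' (f s) = rleg S s"
    using span_isoE[OF assms(3)] by metis
  obtain h where h: "bij_betw h (pts (apex T)) (pts (apex T'))"
    "\<And>s. s \<in> pts (apex T) \<Longrightarrow> h s \<in> pts (apex T')"
    "\<And>g s. g \<in> carrier G \<Longrightarrow> s \<in> pts (apex T)
      \<Longrightarrow> h (gact (apex T) g s) = gact (apex T') g (h s)"
    "\<And>s. s \<in> pts (apex T) \<Longrightarrow> lleg T' (h s) = lleg T s"
    "\<And>s. s \<in> pts (apex T) \<Longrightarrow> rleg T' (h s) = rleg T s"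
    using span_isoE[OF assms(4)] by metis
  let ?P = "pts (apex (pullback_span S T))" and ?P' = "pts (apex (pullback_span S' T'))"
  have "inj_on (map_prod f h) ?P"
    using f(1) h(1)
    by (auto simp: bij_betw_def pullback_span_simps intro!: inj_onI dest: inj_onD)
  moreover have "map_prod f h ` ?P = ?P'"
  proof (intro equalityI subsetI)
    fix p assume "p \<in> ?P'"
    then obtain s' t' where p: "p = (s', t')" "s' \<in> pts (apex S')" "t' \<in> pts (apex T')"
      "rleg S' s' = lleg T' t'"
      by (auto simp: pullback_span_simps)
    then obtain s t where "s \<in> pts (apex S)" "s' = f s" "t \<in> pts (apex T)" "t' = h t"
      using f(1) h(1) by (metis bij_betw_imp_surj_on imageE)
    with p have "p = map_prod f h (s, t)" "(s, t) \<in> ?P"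
      using f h by (auto simp: pullback_span_simps)
    then show "p \<in> map_prod f h ` ?P" by blast
  qed (use f h in \<open>auto simp: pullback_span_simps\<close>)
  ultimately have "bij_betw (map_prod f h) ?P ?P'" by (simp add: bij_betw_def)
  then show ?thesis
    by (rule span_isoI[OF pullback_span_in_spans[OF S T]])
      (use f h S T in \<open>auto simp: pullback_span_simps\<close>)
qed

lemma id_span_in_spans: "finite_gset G X \<Longrightarrow> id_span X \<in> spans G X X"
  by (auto simp: spans_def id_span_def intro!: gmapsI)

text \<open>A point of this pullback is determined by its component \<open>s\<close> in
  \<open>S\<close>, the other component being forced to be \<open>lleg S s\<close>.\<close>

lemma pullback_id_span:
  assumes S: "S \<in> spans G X Y" and X: "finite_gset G X"
  shows "span_iso G (pullback_span (id_span X) S) S"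
proof (rule span_isoI[OF pullback_span_in_spans[OF id_span_in_spans[OF X] S]])
  show "bij_betw snd (pts (apex (pullback_span (id_span X) S))) (pts (apex S))"
    by (rule bij_betw_byWitness[where f' = "\<lambda>s. (lleg S s, s)"])
      (use S in \<open>auto simp: pullback_span_simps id_span_def\<close>)
qed (use S in \<open>auto simp: pullback_span_simps id_span_def\<close>)

lemma pullback_span_id:
  assumes S: "S \<in> spans G X Y" and Y: "finite_gset G Y"
  shows "span_iso G (pullback_span S (id_span Y)) S"
proof (rule span_isoI[OF pullback_span_in_spans[OF S id_span_in_spans[OF Y]]])
  show "bij_betw fst (pts (apex (pullback_span S (id_span Y)))) (pts (apex S))"
    by (rule bij_betw_byWitness[where f' = "\<lambda>s. (s, rleg S s)"])
      (use S in \<open>auto simp: pullback_span_simps id_span_def\<close>)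
qed (use S in \<open>auto simp: pullback_span_simps id_span_def\<close>)

text \<open>Both apexes consist of the triples with \<open>rleg S s = lleg T t\<close> and
  \<open>rleg T t = lleg U u\<close>; only the bracketing, and hence the type, differs.\<close>

lemma pullback_span_assoc:
  assumes S: "S \<in> spans G W X" and T: "T \<in> spans G X Y" and U: "U \<in> spans G Y Z"
  shows "span_iso G (pullback_span (pullback_span S T) U) (pullback_span S (pullback_span T U))"
proof (rule span_isoI)
  let ?f = "\<lambda>((s, t), u). (s, (t, u))"
  show "bij_betw ?f (pts (apex (pullback_span (pullback_span S T) U)))
      (pts (apex (pullback_span S (pullback_span T U))))"
    by (rule bij_betw_byWitness[where f' = "\<lambda>(s, (t, u)). ((s, t), u)"])
      (auto simp: pullback_span_simps)
  show "pullback_span (pullback_span S T) U \<in> spans G W Z"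
    by (intro pullback_span_in_spans[OF pullback_span_in_spans[OF S T] U])
qed (use S T U in \<open>auto simp: pullback_span_simps\<close>)

text \<open>\<open>Cmp\<close> is a union over all pairs of representatives. By invariance under
  isomorphism its members coincide, and since both classes are nonempty the union is that common
  class.\<close>

lemma Cmp_span_class:
  fixes S :: "('a, 's, 'x) gspan" and T :: "('a, 't, 'x) gspan"
  assumes inf: "infinite (UNIV :: 'x set)" and S: "S \<in> spans G X Y" and T: "T \<in> spans G Y Z"
  shows "Cmp (Spn G) X Y Z (span_class G Y Z T) (span_class G X Y S)
    = span_class G X Z (pullback_span S T)"
proof -
  have "span_class G X Z (pullback_span S' T') = span_class G X Z (pullback_span S T)"
    if "S' \<in> span_class G X Y S" "T' \<in> span_class G Y Z T" for S' T'
  proof -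
    from that have S': "S' \<in> spans G X Y" "span_iso G S' S"
      and T': "T' \<in> spans G Y Z" "span_iso G T' T"
      by (simp_all add: span_class_def)
    show ?thesis
      using S' T' S T by (intro span_class_eqI[OF pullback_span_in_spans[OF S'(1) T'(1)]
            pullback_span_in_spans[OF S T] pullback_span_iso[OF S'(1) T'(1)]])
  qed
  then show ?thesis
    using span_class_nonempty[OF inf S] span_class_nonempty[OF inf T]
    by (auto simp: Spn_def)
qed

lemma category_Spn:
  assumes inf: "infinite (UNIV :: 'x set)"
  shows "category (Spn G :: (('a, 'x) gset, ('a, 'x, 'x) gspan set) add_cat)"
    (is "category ?C")
proof
  have Ident: "Ident ?C X = span_class G X X (id_span X)" for X
    by (simp add: Spn_def)
  have Obj: "X \<in> Obj ?C \<longleftrightarrow> finite_gset G X" for X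
    by (simp add: Spn_def)
  show "Ident ?C X \<in> Hom ?C X X" if "X \<in> Obj ?C" for X
    unfolding Ident using that Obj by (intro span_class_in_Hom inf id_span_in_spans) simp
  show "Cmp ?C X Y Z B A \<in> Hom ?C X Z" if "A \<in> Hom ?C X Y" "B \<in> Hom ?C Y Z" for X Y Z A B
    using that
  proof -
    from that(1) obtain S :: "('a, 'x, 'x) gspan" where S: "S \<in> spans G X Y"
      and A: "A = span_class G X Y S" by (rule Hom_SpnE)
    from that(2) obtain T :: "('a, 'x, 'x) gspan" where T: "T \<in> spans G Y Z"
      and B: "B = span_class G Y Z T" by (rule Hom_SpnE)
    show ?thesis
      unfolding A B Cmp_span_class[OF inf S T]
      by (intro span_class_in_Hom[OF inf] pullback_span_in_spans[OF S T])
  qed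
  show "Cmp ?C X X Y A (Ident ?C X) = A" if "X \<in> Obj ?C" "A \<in> Hom ?C X Y" for X Y A
  proof -
    from that(2) obtain S :: "('a, 'x, 'x) gspan" where S: "S \<in> spans G X Y"
      and A: "A = span_class G X Y S" by (rule Hom_SpnE)
    have X: "finite_gset G X" using that Obj by simp
    show ?thesis
      unfolding A Ident Cmp_span_class[OF inf id_span_in_spans[OF X] S]
      by (rule span_class_eqI[OF pullback_span_in_spans[OF id_span_in_spans[OF X] S] S
            pullback_id_span[OF S X]])
  qed
  show "Cmp ?C X Y Y (Ident ?C Y) A = A" if "Y \<in> Obj ?C" "A \<in> Hom ?C X Y" for X Y A
  proof -
    from that(2) obtain S :: "('a, 'x, 'x) gspan" where S: "S \<in> spans G X Y"
      and A: "A = span_class G X Y S" by (rule Hom_SpnE)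
    have Y: "finite_gset G Y" using that Obj by simp
    show ?thesis
      unfolding A Ident Cmp_span_class[OF inf S id_span_in_spans[OF Y]]
      by (rule span_class_eqI[OF pullback_span_in_spans[OF S id_span_in_spans[OF Y]] S
            pullback_span_id[OF S Y]])
  qed
  show "Cmp ?C W Y Z C (Cmp ?C W X Y B A) = Cmp ?C W X Z (Cmp ?C X Y Z C B) A"
    if "A \<in> Hom ?C W X" "B \<in> Hom ?C X Y" "C \<in> Hom ?C Y Z" for W X Y Z A B C
  proof -
    from that(1) obtain S :: "('a, 'x, 'x) gspan" where S: "S \<in> spans G W X"
      and A: "A = span_class G W X S" by (rule Hom_SpnE)
    from that(2) obtain T :: "('a, 'x, 'x) gspan" where T: "T \<in> spans G X Y"
      and B: "B = span_class G X Y T" by (rule Hom_SpnE)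
    from that(3) obtain U :: "('a, 'x, 'x) gspan" where U: "U \<in> spans G Y Z"
      and C: "C = span_class G Y Z U" by (rule Hom_SpnE)
    note ST = pullback_span_in_spans[OF S T] and TU = pullback_span_in_spans[OF T U]
    show ?thesis
      unfolding A B C Cmp_span_class[OF inf S T] Cmp_span_class[OF inf T U]
        Cmp_span_class[OF inf ST U] Cmp_span_class[OF inf S TU]
      by (rule span_class_eqI[OF pullback_span_in_spans[OF ST U]
            pullback_span_in_spans[OF S TU] pullback_span_assoc[OF S T U]])
  qed
qed

section \<open>Addition of spans by disjoint union\<close>

lemma sum_span_simps:
  "pts (apex (sum_span S T)) = pts (apex S) <+> pts (apex T)"
  "s \<in> pts (apex S) \<Longrightarrow> gact (apex (sum_span S T)) g (Inl s) = Inl (gact (apex S) g s)"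
  "t \<in> pts (apex T) \<Longrightarrow> gact (apex (sum_span S T)) g (Inr t) = Inr (gact (apex T) g t)"
  "s \<in> pts (apex S) \<Longrightarrow> lleg (sum_span S T) (Inl s) = lleg S s"
  "t \<in> pts (apex T) \<Longrightarrow> lleg (sum_span S T) (Inr t) = lleg T t"
  "s \<in> pts (apex S) \<Longrightarrow> rleg (sum_span S T) (Inl s) = rleg S s"
  "t \<in> pts (apex T) \<Longrightarrow> rleg (sum_span S T) (Inr t) = rleg T t"
  by (simp_all add: sum_span_def Let_def InlI InrI)

lemma sum_span_extensional:
  "gact (apex (sum_span S T)) g \<in> extensional (pts (apex (sum_span S T)))"
  "lleg (sum_span S T) \<in> extensional (pts (apex (sum_span S T)))"
  "rleg (sum_span S T) \<in> extensional (pts (apex (sum_span S T)))"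
  by (simp_all add: sum_span_def Let_def)

lemma sum_span_in_spans:
  assumes S: "S \<in> spans G X Y" and T: "T \<in> spans G X Y"
  shows "sum_span S T \<in> spans G X Y"
  unfolding spans_def
proof (intro CollectI conjI)
  show "finite_gset G (apex (sum_span S T))"
    using S T spans_apex[OF S] spans_apex[OF T]
    by (intro finite_gsetI sum_span_extensional)
      (auto simp: sum_span_simps gact_mult spans_finite InlI InrI)
  show "lleg (sum_span S T) \<in> gmaps G (apex (sum_span S T)) X"
    "rleg (sum_span S T) \<in> gmaps G (apex (sum_span S T)) Y"
    using S T by (auto intro!: gmapsI sum_span_extensional simp: sum_span_simps)
qed

lemma sum_span_iso:
  assumes S: "S \<in> spans G X Y" and T: "T \<in> spans G X Y"
    and "span_iso G S S'" and "span_iso G T T'"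
  shows "span_iso G (sum_span S T) (sum_span S' T')"
proof -
  obtain f where f: "bij_betw f (pts (apex S)) (pts (apex S'))"
    "\<And>s. s \<in> pts (apex S) \<Longrightarrow> f s \<in> pts (apex S')"
    "\<And>g s. g \<in> carrier G \<Longrightarrow> s \<in> pts (apex S)
      \<Longrightarrow> f (gact (apex S) g s) = gact (apex S') g (f s)"
    "\<And>s. s \<in> pts (apex S) \<Longrightarrow> lleg S' (f s) = lleg S s"
    "\<And>s. s \<in> pts (apex S) \<Longrightarrow> rleg S' (f s) = rleg S s"
    using span_isoE[OF assms(3)] by metis
  obtain h where h: "bij_betw h (pts (apex T)) (pts (apex T'))"
    "\<And>s. s \<in> pts (apex T) \<Longrightarrow> h s \<in> pts (apex T')"
    "\<And>g s. g \<in> carrier G \<Longrightarrow> s \<in> pts (apex T)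
      \<Longrightarrow> h (gact (apex T) g s) = gact (apex T') g (h s)"
    "\<And>s. s \<in> pts (apex T) \<Longrightarrow> lleg T' (h s) = lleg T s"
    "\<And>s. s \<in> pts (apex T) \<Longrightarrow> rleg T' (h s) = rleg T s"
    using span_isoE[OF assms(4)] by metis
  have "bij_betw (map_sum f h) (pts (apex (sum_span S T))) (pts (apex (sum_span S' T')))"
  proof -
    have "map_sum f h ` (A <+> B) = f ` A <+> h ` B" for A B
      by (auto simp: Plus_def image_Un image_image)
    moreover have "inj_on (map_sum f h) (pts (apex S) <+> pts (apex T))"
      using f(1) h(1) by (auto simp: bij_betw_def intro!: inj_onI dest: inj_onD)
    ultimately show ?thesis
      using f(1) h(1) by (simp add: sum_span_simps bij_betw_def)
  qed
  then show ?thesis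
    by (rule span_isoI[OF sum_span_in_spans[OF S T]])
      (use f h S T in \<open>auto simp: sum_span_simps\<close>)
qed

text \<open>As for composition, the union over representatives runs over a nonempty family with one
  and the same member.\<close>

lemma Add_span_class:
  fixes S :: "('a, 's, 'x) gspan" and T :: "('a, 't, 'x) gspan"
  assumes inf: "infinite (UNIV :: 'x set)" and S: "S \<in> spans G X Y" and T: "T \<in> spans G X Y"
  shows "Add (Spn G) X Y (span_class G X Y S) (span_class G X Y T)
    = span_class G X Y (sum_span S T)"
proof -
  have "span_class G X Y (sum_span S' T') = span_class G X Y (sum_span S T)"
    if "S' \<in> span_class G X Y S" "T' \<in> span_class G X Y T" for S' T'
  proof -
    from that have S': "S' \<in> spans G X Y" "span_iso G S' S"
      and T': "T' \<in> spans G X Y" "span_iso G T' T"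
      by (simp_all add: span_class_def)
    show ?thesis
      using S' T' S T by (intro span_class_eqI[OF sum_span_in_spans[OF S'(1) T'(1)]
            sum_span_in_spans[OF S T] sum_span_iso[OF S'(1) T'(1)]])
  qed
  then show ?thesis
    using span_class_nonempty[OF inf S] span_class_nonempty[OF inf T]
    by (auto simp: Spn_def)
qed

end

section \<open>Linear maps, representations and functor categories\<close>

lemma linear_mapsI:
  assumes "f \<in> extensional (carrier V)"
    and "\<And>v. v \<in> carrier V \<Longrightarrow> f v \<in> carrier W"
    and "\<And>v w. v \<in> carrier V \<Longrightarrow> w \<in> carrier V \<Longrightarrow> f (v \<oplus>\<^bsub>V\<^esub> w) = f v \<oplus>\<^bsub>W\<^esub> f w"
    and "\<And>c v. c \<in> carrier K \<Longrightarrow> v \<in> carrier V \<Longrightarrow> f (c \<odot>\<^bsub>V\<^esub> v) = c \<odot>\<^bsub>W\<^esub> f v"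
  shows "f \<in> linear_maps K V W"
  using assms by (auto simp: linear_maps_def module_hom_def)

lemma linear_mapsD:
  assumes "f \<in> linear_maps K V W"
  shows linear_maps_extensional: "f \<in> extensional (carrier V)"
    and linear_maps_closed: "v \<in> carrier V \<Longrightarrow> f v \<in> carrier W"
    and linear_maps_add: "v \<in> carrier V \<Longrightarrow> w \<in> carrier V \<Longrightarrow> f (v \<oplus>\<^bsub>V\<^esub> w) = f v \<oplus>\<^bsub>W\<^esub> f w"
    and linear_maps_smult: "c \<in> carrier K \<Longrightarrow> v \<in> carrier V \<Longrightarrow> f (c \<odot>\<^bsub>V\<^esub> v) = c \<odot>\<^bsub>W\<^esub> f v"
  using assms by (auto simp: linear_maps_def module_hom_def)

lemma linear_maps_id:
  assumes "module K V"
  shows "(\<lambda>v \<in> carrier V. v) \<in> linear_maps K V V"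
proof -
  interpret module K V by (rule assms)
  show ?thesis by (rule linear_mapsI) auto
qed

lemma linear_maps_compose:
  assumes "module K U" "e \<in> linear_maps K U V" "f \<in> linear_maps K V W"
  shows "compose (carrier U) f e \<in> linear_maps K U W"
proof -
  interpret module K U by (rule assms(1))
  note e = linear_mapsD[OF assms(2)] and f = linear_mapsD[OF assms(3)]
  show ?thesis by (rule linear_mapsI) (auto simp: compose_def e f)
qed

lemma linear_maps_zero:
  assumes "module K V" "module K W" and f: "f \<in> linear_maps K V W"
  shows "f \<zero>\<^bsub>V\<^esub> = \<zero>\<^bsub>W\<^esub>"
proof -
  interpret V: module K V by (rule assms(1))
  interpret W: module K W by (rule assms(2))
  \<comment> \<open>\<open>linear_maps\<close> speaks of sums and scalar multiples only, so the zero
    vector is written as the scalar zero times itself.\<close>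
  have "f (\<zero>\<^bsub>K\<^esub> \<odot>\<^bsub>V\<^esub> \<zero>\<^bsub>V\<^esub>) = \<zero>\<^bsub>K\<^esub> \<odot>\<^bsub>W\<^esub> f \<zero>\<^bsub>V\<^esub>"
    by (rule linear_maps_smult[OF f]) simp_all
  then show ?thesis using linear_maps_closed[OF f] by simp
qed

lemma linear_maps_finsum:
  assumes "module K V" "module K W" and f: "f \<in> linear_maps K V W"
    and "finite A" "\<And>a. a \<in> A \<Longrightarrow> v a \<in> carrier V"
  shows "f (\<Oplus>\<^bsub>V\<^esub>a\<in>A. v a) = (\<Oplus>\<^bsub>W\<^esub>a\<in>A. f (v a))"
proof -
  interpret V: module K V by (rule assms(1))
  interpret W: module K W by (rule assms(2))
  show ?thesis
    using assms(4,5)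
  proof (induction rule: finite_induct)
    case empty
    then show ?case using linear_maps_zero[OF assms(1,2) f] by simp
  next
    case (insert a A)
    then show ?case
      by (simp add: linear_maps_add[OF f] linear_maps_closed[OF f] Pi_iff)
  qed
qed

lemma extensional_compose [simp]: "compose A f e \<in> extensional A"
  by (simp add: compose_def)

lemma category_Vect: "category (Vect K :: (('k, 'v) module, 'v \<Rightarrow> 'v) add_cat)"
proof
  fix U V W X :: "('k, 'v) module" and a b c
  show "X \<in> Obj (Vect K) \<Longrightarrow> Ident (Vect K) X \<in> Hom (Vect K) X X"
    by (simp add: Vect_def linear_maps_id vectorspace_def)
  show "\<lbrakk>U \<in> Obj (Vect K); V \<in> Obj (Vect K); W \<in> Obj (Vect K); a \<in> Hom (Vect K) U V;
      b \<in> Hom (Vect K) V W\<rbrakk> \<Longrightarrow> Cmp (Vect K) U V W b a \<in> Hom (Vect K) U W"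
    by (auto simp: Vect_def vectorspace_def intro: linear_maps_compose)
  show "\<lbrakk>U \<in> Obj (Vect K); V \<in> Obj (Vect K); a \<in> Hom (Vect K) U V\<rbrakk>
      \<Longrightarrow> Cmp (Vect K) U U V a (Ident (Vect K) U) = a"
    by (auto simp: Vect_def compose_def dest: linear_maps_extensional
        intro!: extensionalityI[of _ "carrier U"])
  show "\<lbrakk>U \<in> Obj (Vect K); V \<in> Obj (Vect K); a \<in> Hom (Vect K) U V\<rbrakk>
      \<Longrightarrow> Cmp (Vect K) U V V (Ident (Vect K) V) a = a"
    by (auto simp: Vect_def compose_def dest: linear_maps_extensional linear_maps_closed
        intro!: extensionalityI[of _ "carrier U"])
  show "\<lbrakk>U \<in> Obj (Vect K); V \<in> Obj (Vect K); W \<in> Obj (Vect K); X \<in> Obj (Vect K);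
      a \<in> Hom (Vect K) U V; b \<in> Hom (Vect K) V W; c \<in> Hom (Vect K) W X\<rbrakk>
      \<Longrightarrow> Cmp (Vect K) U W X c (Cmp (Vect K) U V W b a)
        = Cmp (Vect K) U V X (Cmp (Vect K) V W X c b) a"
    by (auto simp: Vect_def compose_def dest: linear_maps_closed
        intro!: extensionalityI[of _ "carrier U"])
qed

section \<open>Homomorphisms of representations and the category \<open>Rep\<close>\<close>

lemma rep_homI:
  assumes "f \<in> linear_maps K (space Q) (space R)"
    and "\<And>g v. g \<in> carrier G \<Longrightarrow> v \<in> carrier (space Q) \<Longrightarrow> f (ract Q g v) = ract R g (f v)"
  shows "f \<in> rep_hom K G Q R"
  using assms by (simp add: rep_hom_def)

lemma rep_homD:
  assumes "f \<in> rep_hom K G Q R"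
  shows rep_hom_linear: "f \<in> linear_maps K (space Q) (space R)"
    and rep_hom_equivariant:
      "g \<in> carrier G \<Longrightarrow> v \<in> carrier (space Q) \<Longrightarrow> f (ract Q g v) = ract R g (f v)"
  using assms by (simp_all add: rep_hom_def)

lemma rep_hom_eqI:
  assumes "e \<in> rep_hom K G Q R" "f \<in> rep_hom K G Q R"
    and "\<And>v. v \<in> carrier (space Q) \<Longrightarrow> e v = f v"
  shows "e = f"
  using assms by (auto dest!: rep_hom_linear linear_maps_extensional
      intro: extensionalityI[of _ "carrier (space Q)"])

lemma representation_module: "representation K G R \<Longrightarrow> module K (space R)"
  by (simp add: representation_def vectorspace_def)

lemma representation_ract:
  assumes "representation K G R" "g \<in> carrier G"
  shows "ract R g \<in> linear_maps K (space R) (space R)"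
  using assms by (simp add: representation_def)

text \<open>The premises on the source are the module structure and closure under the action,
  because these are the two facts established for permutation representations, the source in most
  uses.\<close>

lemma rep_hom_compose:
  assumes P: "module K (space P)"
      "\<And>g v. g \<in> carrier G \<Longrightarrow> v \<in> carrier (space P) \<Longrightarrow> ract P g v \<in> carrier (space P)"
    and e: "e \<in> rep_hom K G P Q" and f: "f \<in> rep_hom K G Q R"
  shows "compose (carrier (space P)) f e \<in> rep_hom K G P R"
proof (rule rep_homI)
  show "compose (carrier (space P)) f e \<in> linear_maps K (space P) (space R)"
    by (rule linear_maps_compose[OF P(1) rep_hom_linear[OF e] rep_hom_linear[OF f]])
qed (simp add: compose_def P(2) rep_hom_equivariant[OF e] rep_hom_equivariant[OF f]
    linear_maps_closed[OF rep_hom_linear[OF e]])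

lemma category_Rep: "category (Rep K G :: (('g, 'k, 'v) rep, 'v \<Rightarrow> 'v) cat)"
proof
  fix U V W X :: "('g, 'k, 'v) rep" and a b c
  show "X \<in> Obj (Rep K G) \<Longrightarrow> Ident (Rep K G) X \<in> Hom (Rep K G) X X"
    by (auto simp: Rep_def intro!: rep_homI linear_maps_id representation_module
        dest: linear_maps_closed[OF representation_ract])
  show "\<lbrakk>U \<in> Obj (Rep K G); V \<in> Obj (Rep K G); W \<in> Obj (Rep K G); a \<in> Hom (Rep K G) U V;
      b \<in> Hom (Rep K G) V W\<rbrakk> \<Longrightarrow> Cmp (Rep K G) U V W b a \<in> Hom (Rep K G) U W"
    by (auto simp: Rep_def intro!: rep_hom_compose representation_module
        dest: linear_maps_closed[OF representation_ract])
  show "\<lbrakk>U \<in> Obj (Rep K G); V \<in> Obj (Rep K G); a \<in> Hom (Rep K G) U V\<rbrakk>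
      \<Longrightarrow> Cmp (Rep K G) U U V a (Ident (Rep K G) U) = a"
    by (auto simp: Rep_def compose_def dest!: rep_hom_linear dest: linear_maps_extensional
        intro!: extensionalityI[of _ "carrier (space U)"])
  show "\<lbrakk>U \<in> Obj (Rep K G); V \<in> Obj (Rep K G); a \<in> Hom (Rep K G) U V\<rbrakk>
      \<Longrightarrow> Cmp (Rep K G) U V V (Ident (Rep K G) V) a = a"
    by (auto simp: Rep_def compose_def dest!: rep_hom_linear
        dest: linear_maps_extensional linear_maps_closed
        intro!: extensionalityI[of _ "carrier (space U)"])
  show "\<lbrakk>U \<in> Obj (Rep K G); V \<in> Obj (Rep K G); W \<in> Obj (Rep K G); X \<in> Obj (Rep K G);
      a \<in> Hom (Rep K G) U V; b \<in> Hom (Rep K G) V W; c \<in> Hom (Rep K G) W X\<rbrakk>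
      \<Longrightarrow> Cmp (Rep K G) U W X c (Cmp (Rep K G) U V W b a)
        = Cmp (Rep K G) U V X (Cmp (Rep K G) V W X c b) a"
    by (auto simp: Rep_def compose_def dest!: rep_hom_linear dest: linear_maps_closed
        intro!: extensionalityI[of _ "carrier (space U)"])
qed

section \<open>Natural transformations and the category \<open>Mky\<close>\<close>

lemma nat_transI:
  assumes "\<theta> \<in> extensional (Obj C)"
    and "\<And>X. X \<in> Obj C \<Longrightarrow> \<theta> X \<in> Hom D (fobj M X) (fobj N X)"
    and "\<And>X Y a. X \<in> Obj C \<Longrightarrow> Y \<in> Obj C \<Longrightarrow> a \<in> Hom C X Y
      \<Longrightarrow> Cmp D (fobj M X) (fobj N X) (fobj N Y) (fmap N X Y a) (\<theta> X)
        = Cmp D (fobj M X) (fobj M Y) (fobj N Y) (\<theta> Y) (fmap M X Y a)"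
  shows "\<theta> \<in> nat_trans C D M N"
  using assms by (simp add: nat_trans_def)

lemma nat_transD:
  assumes "\<theta> \<in> nat_trans C D M N"
  shows nat_trans_extensional: "\<theta> \<in> extensional (Obj C)"
    and nat_trans_in: "X \<in> Obj C \<Longrightarrow> \<theta> X \<in> Hom D (fobj M X) (fobj N X)"
    and nat_trans_natural: "X \<in> Obj C \<Longrightarrow> Y \<in> Obj C \<Longrightarrow> a \<in> Hom C X Y
      \<Longrightarrow> Cmp D (fobj M X) (fobj N X) (fobj N Y) (fmap N X Y a) (\<theta> X)
        = Cmp D (fobj M X) (fobj M Y) (fobj N Y) (\<theta> Y) (fmap M X Y a)"
  using assms by (simp_all add: nat_trans_def)

lemma nat_trans_id:
  assumes "cat_functor C D M"
  shows "(\<lambda>X \<in> Obj C. Ident D (fobj M X)) \<in> nat_trans C D M M"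
proof -
  interpret cat_functor C D M by (rule assms)
  show ?thesis
    by (rule nat_transI) (simp_all add: D.Ident_in D.Cmp_Ident D.Ident_Cmp fobj_in fmap_in)
qed

text \<open>The naturality squares of \<theta> and \<phi> share the edge \<open>fmap M X Y a\<close>
  and are pasted along it.\<close>

lemma nat_trans_compose:
  assumes "cat_functor C D L" "cat_functor C D M" "cat_functor C D N"
    and \<theta>: "\<theta> \<in> nat_trans C D L M" and \<phi>: "\<phi> \<in> nat_trans C D M N"
  shows "(\<lambda>X \<in> Obj C. Cmp D (fobj L X) (fobj M X) (fobj N X) (\<phi> X) (\<theta> X)) \<in> nat_trans C D L N"
proof -
  interpret L: cat_functor C D L by (rule assms)
  interpret M: cat_functor C D M by (rule assms)
  interpret N: cat_functor C D N by (rule assms)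
  note obj = L.fobj_in M.fobj_in N.fobj_in
  show ?thesis
  proof (rule nat_transI)
    fix X Y a assume X: "X \<in> Obj C" and Y: "Y \<in> Obj C" and a: "a \<in> Hom C X Y"
    note maps = L.fmap_in[OF X Y a] M.fmap_in[OF X Y a] N.fmap_in[OF X Y a]
      nat_trans_in[OF \<theta> X] nat_trans_in[OF \<theta> Y] nat_trans_in[OF \<phi> X] nat_trans_in[OF \<phi> Y]
    have "Cmp D (fobj L X) (fobj N X) (fobj N Y) (fmap N X Y a)
        (Cmp D (fobj L X) (fobj M X) (fobj N X) (\<phi> X) (\<theta> X))
      = Cmp D (fobj L X) (fobj M X) (fobj N Y)
        (Cmp D (fobj M X) (fobj N X) (fobj N Y) (fmap N X Y a) (\<phi> X)) (\<theta> X)"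
      by (intro L.D.Cmp_assoc obj X Y maps)
    also have "\<dots> = Cmp D (fobj L X) (fobj M X) (fobj N Y)
        (Cmp D (fobj M X) (fobj M Y) (fobj N Y) (\<phi> Y) (fmap M X Y a)) (\<theta> X)"
      by (simp only: nat_trans_natural[OF \<phi> X Y a])
    also have "\<dots> = Cmp D (fobj L X) (fobj M Y) (fobj N Y) (\<phi> Y)
        (Cmp D (fobj L X) (fobj M X) (fobj M Y) (fmap M X Y a) (\<theta> X))"
      by (intro L.D.Cmp_assoc[symmetric] obj X Y maps)
    also have "\<dots> = Cmp D (fobj L X) (fobj M Y) (fobj N Y) (\<phi> Y)
        (Cmp D (fobj L X) (fobj L Y) (fobj M Y) (\<theta> Y) (fmap L X Y a))"
      by (simp only: nat_trans_natural[OF \<theta> X Y a])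
    also have "\<dots> = Cmp D (fobj L X) (fobj L Y) (fobj N Y)
        (Cmp D (fobj L Y) (fobj M Y) (fobj N Y) (\<phi> Y) (\<theta> Y)) (fmap L X Y a)"
      by (intro L.D.Cmp_assoc obj X Y maps)
    finally show "Cmp D (fobj L X) (fobj N X) (fobj N Y) (fmap N X Y a)
        ((\<lambda>X \<in> Obj C. Cmp D (fobj L X) (fobj M X) (fobj N X) (\<phi> X) (\<theta> X)) X)
      = Cmp D (fobj L X) (fobj L Y) (fobj N Y)
        ((\<lambda>X \<in> Obj C. Cmp D (fobj L X) (fobj M X) (fobj N X) (\<phi> X) (\<theta> X)) Y) (fmap L X Y a)"
      using X Y by simp
  next
    fix X assume X: "X \<in> Obj C"
    then show "(\<lambda>X \<in> Obj C. Cmp D (fobj L X) (fobj M X) (fobj N X) (\<phi> X) (\<theta> X)) X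
        \<in> Hom D (fobj L X) (fobj N X)"
      by (simp add: L.D.Cmp_in[OF obj(1-3)[OF X] nat_trans_in[OF \<theta> X] nat_trans_in[OF \<phi> X]])
  qed simp
qed

text \<open>The laws hold at each object because they hold in \<open>Vect\<close>. As
  transformations are extensional on the objects, agreement of all components is equality.\<close>

lemma category_Mky:
  "category (Mky K G :: (('g, 'k, 'x, 'w) mackey, ('g, 'x) gset \<Rightarrow> 'w \<Rightarrow> 'w) cat)"
proof
  fix L M N P :: "('g, 'k, 'x, 'w) mackey" and \<theta> \<phi> \<psi>
  have is_functor: "cat_functor (Spn G) (Vect K) M" if "M \<in> Obj (Mky K G)" for M :: "('g, 'k, 'x, 'w) mackey"
    using that by (simp add: Mky_def additive_functor_def)
  have obj: "fobj M X \<in> Obj (Vect K)" if "M \<in> Obj (Mky K G)" "X \<in> Obj (Spn G)"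
    for M :: "('g, 'k, 'x, 'w) mackey" and X
    using is_functor[OF that(1)] that(2) by (rule cat_functor.fobj_in)
  have Hom: "Hom (Mky K G) L M = nat_trans (Spn G) (Vect K) L M"
    for L M :: "('g, 'k, 'x, 'w) mackey"
    by (simp add: Mky_def)
  interpret D: category "Vect K" by (rule category_Vect)
  show "M \<in> Obj (Mky K G) \<Longrightarrow> Ident (Mky K G) M \<in> Hom (Mky K G) M M"
    using nat_trans_id[OF is_functor] by (simp add: Mky_def)
  show "\<lbrakk>L \<in> Obj (Mky K G); M \<in> Obj (Mky K G); N \<in> Obj (Mky K G); \<theta> \<in> Hom (Mky K G) L M;
      \<phi> \<in> Hom (Mky K G) M N\<rbrakk> \<Longrightarrow> Cmp (Mky K G) L M N \<phi> \<theta> \<in> Hom (Mky K G) L N"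
    using nat_trans_compose[OF is_functor is_functor is_functor] by (simp add: Mky_def)
  show "Cmp (Mky K G) L L M \<theta> (Ident (Mky K G) L) = \<theta>"
    if "L \<in> Obj (Mky K G)" "M \<in> Obj (Mky K G)" "\<theta> \<in> Hom (Mky K G) L M"
  proof (rule extensionalityI)
    have \<theta>: "\<theta> \<in> nat_trans (Spn G) (Vect K) L M" using that Hom by simp
    show "\<theta> \<in> extensional (Obj (Spn G))" by (rule nat_trans_extensional[OF \<theta>])
  next
    fix X :: "('g, 'x) gset" assume X: "X \<in> Obj (Spn G)"
    have \<theta>: "\<theta> \<in> nat_trans (Spn G) (Vect K) L M" using that Hom by simp
    show "Cmp (Mky K G) L L M \<theta> (Ident (Mky K G) L) X = \<theta> X"
      using D.Cmp_Ident[OF obj[OF that(1) X] obj[OF that(2) X] nat_trans_in[OF \<theta> X]] X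
      by (simp add: Mky_def)
  qed (simp add: Mky_def)
  show "Cmp (Mky K G) L M M (Ident (Mky K G) M) \<theta> = \<theta>"
    if "L \<in> Obj (Mky K G)" "M \<in> Obj (Mky K G)" "\<theta> \<in> Hom (Mky K G) L M"
  proof (rule extensionalityI)
    have \<theta>: "\<theta> \<in> nat_trans (Spn G) (Vect K) L M" using that Hom by simp
    show "\<theta> \<in> extensional (Obj (Spn G))" by (rule nat_trans_extensional[OF \<theta>])
  next
    fix X :: "('g, 'x) gset" assume X: "X \<in> Obj (Spn G)"
    have \<theta>: "\<theta> \<in> nat_trans (Spn G) (Vect K) L M" using that Hom by simp
    show "Cmp (Mky K G) L M M (Ident (Mky K G) M) \<theta> X = \<theta> X"
      using D.Ident_Cmp[OF obj[OF that(1) X] obj[OF that(2) X] nat_trans_in[OF \<theta> X]] X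
      by (simp add: Mky_def)
  qed (simp add: Mky_def)
  show "Cmp (Mky K G) L N P \<psi> (Cmp (Mky K G) L M N \<phi> \<theta>)
      = Cmp (Mky K G) L M P (Cmp (Mky K G) M N P \<psi> \<phi>) \<theta>"
    if "L \<in> Obj (Mky K G)" "M \<in> Obj (Mky K G)" "N \<in> Obj (Mky K G)" "P \<in> Obj (Mky K G)"
      "\<theta> \<in> Hom (Mky K G) L M" "\<phi> \<in> Hom (Mky K G) M N" "\<psi> \<in> Hom (Mky K G) N P"
  proof -
    have "Cmp (Vect K) (fobj L X) (fobj N X) (fobj P X) (\<psi> X)
        (Cmp (Vect K) (fobj L X) (fobj M X) (fobj N X) (\<phi> X) (\<theta> X))
      = Cmp (Vect K) (fobj L X) (fobj M X) (fobj P X)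
        (Cmp (Vect K) (fobj M X) (fobj N X) (fobj P X) (\<psi> X) (\<phi> X)) (\<theta> X)"
      if X: "X \<in> Obj (Spn G)" for X
      using \<open>\<theta> \<in> _\<close> \<open>\<phi> \<in> _\<close> \<open>\<psi> \<in> _\<close> unfolding Hom
      by (intro D.Cmp_assoc obj X \<open>L \<in> _\<close> \<open>M \<in> _\<close> \<open>N \<in> _\<close> \<open>P \<in> _\<close> nat_trans_in[OF _ X])
    then show ?thesis by (auto simp: Mky_def restrict_def)
  qed
qed

section \<open>Permutation representations\<close>

lemma (in abelian_monoid) finsum_reindex_bij_betw:
  assumes "bij_betw h A B" "\<And>b. b \<in> B \<Longrightarrow> f b \<in> carrier G"
  shows "(\<Oplus>a\<in>A. f (h a)) = (\<Oplus>b\<in>B. f b)"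
  using assms by (intro add.finprod_reindex_bij_betw) (auto dest: bij_betwE)

text \<open>The fibres of \<open>h\<close> partition \<open>A\<close>. This merges an iterated sum
  into one sum, once over the right fibres of a span and once over the first components of a
  pullback.\<close>

lemma (in abelian_monoid) finsum_fibres:
  assumes "finite A" "finite B" "\<And>a. a \<in> A \<Longrightarrow> h a \<in> B" "\<And>a. a \<in> A \<Longrightarrow> f a \<in> carrier G"
  shows "(\<Oplus>b\<in>B. \<Oplus>a\<in>{a \<in> A. h a = b}. f a) = (\<Oplus>a\<in>A. f a)"
proof -
  have "A = (\<Union>b\<in>B. {a \<in> A. h a = b})" using assms(3) by auto
  then have "(\<Oplus>a\<in>A. f a) = (\<Oplus>a\<in>(\<Union>b\<in>B. {a \<in> A. h a = b}). f a)" by simp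
  also have "\<dots> = (\<Oplus>b\<in>B. \<Oplus>a\<in>{a \<in> A. h a = b}. f a)"
    using assms by (intro add.finprod_UN_disjoint) (auto simp: pairwise_def disjnt_def)
  finally show ?thesis ..
qed

lemma (in abelian_monoid) finsum_if:
  assumes "finite A" "\<And>a. a \<in> A \<Longrightarrow> f a \<in> carrier G"
  shows "(\<Oplus>a\<in>A. if P a then f a else \<zero>) = (\<Oplus>a\<in>{a \<in> A. P a}. f a)"
  using assms by (intro add.finprod_mono_neutral_cong_right) auto

context cring
begin

lemma func_space_simps:
  "carrier (func_space S) = S \<rightarrow>\<^sub>E carrier R"
  "a \<oplus>\<^bsub>func_space S\<^esub> b = (\<lambda>x \<in> S. a x \<oplus> b x)"
  "c \<odot>\<^bsub>func_space S\<^esub> a = (\<lambda>x \<in> S. c \<otimes> a x)"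
  "\<zero>\<^bsub>func_space S\<^esub> = (\<lambda>x \<in> S. \<zero>)"
  by (simp_all add: func_space_def)

text \<open>Only binary addition in the function module is pointwise by definition, so evaluation at
  a coordinate is passed through the sum by induction on the index set.\<close>

lemma finsum_func_space:
  assumes "finite A" "\<And>a. a \<in> A \<Longrightarrow> f a \<in> carrier (func_space S)" "x \<in> S"
  shows "(\<Oplus>\<^bsub>func_space S\<^esub>a\<in>A. f a) x = (\<Oplus>a\<in>A. f a x)"
proof -
  interpret F: module R "func_space S" by (rule func_space_is_module)
  show ?thesis
    using assms(1,2)
  proof (induction rule: finite_induct)
    case empty
    then show ?case using assms(3) by (simp add: func_space_simps)
  next
    case (insert a A)
    have *: "b \<in> insert a A \<Longrightarrow> f b x \<in> carrier R" for b
      using insert.prems assms(3) by (auto simp: func_space_simps)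
    have "(\<Oplus>\<^bsub>func_space S\<^esub>a\<in>insert a A. f a) = f a \<oplus>\<^bsub>func_space S\<^esub> (\<Oplus>\<^bsub>func_space S\<^esub>a\<in>A. f a)"
      using insert by (intro F.finsum_insert) auto
    then show ?case
      using insert assms(3) * by (simp add: func_space_simps(2) Pi_iff)
  qed
qed

end

section \<open>The linear maps induced by spans, in coordinates\<close>

locale perm_functor = field K + G: group G for K (structure) and G
begin

abbreviation perm_space :: "('c, 'x) gset \<Rightarrow> ('x \<Rightarrow> 'a) set" where
  "perm_space X \<equiv> pts X \<rightarrow>\<^sub>E carrier K"

lemma perm_rep_simps:
  "space (perm_rep K G X) = func_space (pts X)"
  "a \<in> perm_space X \<Longrightarrow> ract (perm_rep K G X) g a = (\<lambda>x \<in> pts X. a (gact X (inv\<^bsub>G\<^esub> g) x))"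
  by (simp_all add: perm_rep_def func_space_simps)

lemma basis_vec_closed: "basis_vec K X x \<in> perm_space X"
  by (auto simp: basis_vec_def)

text \<open>In the defining double sum the coordinate at \<open>x\<close> of the vector for
  \<open>s\<close> is one exactly if \<open>lleg S s = x\<close>, and on the right fibre over
  \<open>y\<close> the scalar \<open>a y\<close> is \<open>a (rleg S s)\<close>. Merging the right
  fibres leaves the sum over the left fibre of \<open>x\<close>.\<close>

lemma perm_span_map_apply:
  assumes S: "S \<in> spans G X Y" and X: "finite_gset G X" and Y: "finite_gset G Y"
    and a: "a \<in> perm_space Y" and x: "x \<in> pts X"
  shows "perm_span_map K X Y S a x = (\<Oplus>s\<in>{s \<in> pts (apex S). lleg S s = x}. a (rleg S s))"
proof -
  interpret F: module K "func_space (pts X)" by (rule func_space_is_module)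
  let ?P = "pts (apex S)"
  note fin = G.finite_pts[OF Y] G.spans_finite[OF S]
  have a_closed: "s \<in> ?P \<Longrightarrow> a (rleg S s) \<in> carrier K" for s
    using G.spans_rleg(1)[OF S] a by auto
  have basis: "basis_vec K X z \<in> carrier (func_space (pts X))" for z
    using basis_vec_closed by (simp add: func_space_simps)
  have fibre: "(a y \<odot>\<^bsub>func_space (pts X)\<^esub>
      (\<Oplus>\<^bsub>func_space (pts X)\<^esub>s\<in>{s \<in> ?P. rleg S s = y}. basis_vec K X (lleg S s))) x
    = (\<Oplus>s\<in>{s \<in> ?P. rleg S s = y}. if lleg S s = x then a (rleg S s) else \<zero>)"
    if y: "y \<in> pts Y" for y
  proof -
    have "a y \<otimes> (\<Oplus>\<^bsub>func_space (pts X)\<^esub>s\<in>{s \<in> ?P. rleg S s = y}. basis_vec K X (lleg S s)) x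
      = a y \<otimes> (\<Oplus>s\<in>{s \<in> ?P. rleg S s = y}. basis_vec K X (lleg S s) x)"
      using fin x basis by (subst finsum_func_space) auto
    also have "\<dots> = (\<Oplus>s\<in>{s \<in> ?P. rleg S s = y}. a y \<otimes> basis_vec K X (lleg S s) x)"
      using fin x a y by (intro finsum_rdistr) (auto simp: basis_vec_def)
    also have "\<dots> = (\<Oplus>s\<in>{s \<in> ?P. rleg S s = y}. if lleg S s = x then a (rleg S s) else \<zero>)"
      using x a y a_closed by (intro finsum_cong') (auto simp: basis_vec_def)
    finally show ?thesis using x by (simp add: func_space_simps)
  qed
  have "perm_span_map K X Y S a x
    = (\<Oplus>\<^bsub>func_space (pts X)\<^esub>y\<in>pts Y. a y \<odot>\<^bsub>func_space (pts X)\<^esub>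
      (\<Oplus>\<^bsub>func_space (pts X)\<^esub>s\<in>{s \<in> ?P. rleg S s = y}. basis_vec K X (lleg S s))) x"
    using a by (simp add: perm_span_map_def Let_def func_space_simps)
  also have "\<dots> = (\<Oplus>y\<in>pts Y. \<Oplus>s\<in>{s \<in> ?P. rleg S s = y}.
      if lleg S s = x then a (rleg S s) else \<zero>)"
  proof (subst finsum_func_space)
    show "a y \<odot>\<^bsub>func_space (pts X)\<^esub>
      (\<Oplus>\<^bsub>func_space (pts X)\<^esub>s\<in>{s \<in> ?P. rleg S s = y}. basis_vec K X (lleg S s))
      \<in> carrier (func_space (pts X))" if "y \<in> pts Y" for y
      using a that basis by (intro F.smult_closed F.finsum_closed) auto
  qed (use fin x a_closed in \<open>auto intro!: finsum_cong' finsum_closed simp: fibre\<close>)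
  also have "\<dots> = (\<Oplus>s\<in>?P. if lleg S s = x then a (rleg S s) else \<zero>)"
    using fin a_closed G.spans_rleg(1)[OF S] by (intro finsum_fibres) auto
  also have "\<dots> = (\<Oplus>s\<in>{s \<in> ?P. lleg S s = x}. a (rleg S s))"
    using fin a_closed by (intro finsum_if) auto
  finally show ?thesis .
qed

lemma perm_span_map_closed:
  assumes S: "S \<in> spans G X Y" and X: "finite_gset G X" and Y: "finite_gset G Y"
    and a: "a \<in> perm_space Y"
  shows "perm_span_map K X Y S a \<in> perm_space X"
proof -
  interpret F: module K "func_space (pts X)" by (rule func_space_is_module)
  have basis: "basis_vec K X x \<in> carrier (func_space (pts X))" for x
    using basis_vec_closed by (simp add: func_space_simps)
  have "a \<in> carrier (func_space (pts Y))" using a by (simp add: func_space_simps)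
  then have "perm_span_map K X Y S a = (\<Oplus>\<^bsub>func_space (pts X)\<^esub>y\<in>pts Y. a y \<odot>\<^bsub>func_space (pts X)\<^esub>
      (\<Oplus>\<^bsub>func_space (pts X)\<^esub>s\<in>{s \<in> pts (apex S). rleg S s = y}. basis_vec K X (lleg S s)))"
    by (simp add: perm_span_map_def Let_def)
  also have "\<dots> \<in> carrier (func_space (pts X))"
    using a basis by (intro F.finsum_closed Pi_I F.smult_closed) auto
  finally have "perm_span_map K X Y S a \<in> carrier (func_space (pts X))" .
  then show ?thesis by (simp add: func_space_simps)
qed

text \<open>Reduces an equation for an induced map to the coordinate formula. The two extensionality
  premises fix the values outside the function space and outside \<open>pts X\<close>.\<close>

lemma perm_span_map_eqI:
  assumes S: "S \<in> spans G X Y" and X: "finite_gset G X" and Y: "finite_gset G Y"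
    and f: "f \<in> extensional (perm_space Y)"
    and "\<And>a. a \<in> perm_space Y \<Longrightarrow> f a \<in> extensional (pts X)"
    and "\<And>a x. a \<in> perm_space Y \<Longrightarrow> x \<in> pts X
      \<Longrightarrow> f a x = (\<Oplus>s\<in>{s \<in> pts (apex S). lleg S s = x}. a (rleg S s))"
  shows "perm_span_map K X Y S = f"
proof (rule extensionalityI[OF _ f])
  show "perm_span_map K X Y S \<in> extensional (perm_space Y)"
    by (simp add: perm_span_map_def Let_def func_space_simps)
  show "perm_span_map K X Y S a = f a" if a: "a \<in> perm_space Y" for a
    using perm_span_map_closed[OF S X Y a] assms(5)[OF a] assms(6)[OF a]
      perm_span_map_apply[OF S X Y a]
    by (intro extensionalityI[of _ "pts X"]) (auto simp: PiE_def)
qed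

text \<open>An isomorphism of spans restricts to bijections between the left fibres and preserves
  right legs, so the coordinate sums agree after reindexing.\<close>

lemma perm_span_map_iso:
  assumes S: "S \<in> spans G X Y" and T: "T \<in> spans G X Y" and "span_iso G S T"
    and X: "finite_gset G X" and Y: "finite_gset G Y"
  shows "perm_span_map K X Y S = perm_span_map K X Y T"
proof (rule perm_span_map_eqI[OF S X Y])
  obtain f where f: "bij_betw f (pts (apex S)) (pts (apex T))"
    "\<And>s. s \<in> pts (apex S) \<Longrightarrow> lleg T (f s) = lleg S s"
    "\<And>s. s \<in> pts (apex S) \<Longrightarrow> rleg T (f s) = rleg S s"
    using G.span_isoE[OF assms(3)] by metis
  fix a x assume a: "a \<in> perm_space Y" and x: "x \<in> pts X"
  have bij: "bij_betw f {s \<in> pts (apex S). lleg S s = x} {t \<in> pts (apex T). lleg T t = x}"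
    using f by (auto simp: bij_betw_def inj_on_subset image_iff) (metis image_iff)+
  have "(\<Oplus>s\<in>{s \<in> pts (apex S). lleg S s = x}. a (rleg S s))
    = (\<Oplus>s\<in>{s \<in> pts (apex S). lleg S s = x}. a (rleg T (f s)))"
    using f G.spans_rleg(1)[OF S] a by (intro finsum_cong') auto
  also have "\<dots> = (\<Oplus>t\<in>{t \<in> pts (apex T). lleg T t = x}. a (rleg T t))"
    using G.spans_rleg(1)[OF T] a by (intro finsum_reindex_bij_betw bij) auto
  finally show "perm_span_map K X Y T a x = (\<Oplus>s\<in>{s \<in> pts (apex S). lleg S s = x}. a (rleg S s))"
    using perm_span_map_apply[OF T X Y a x] by simp
next
  show "perm_span_map K X Y T \<in> extensional (perm_space Y)"
    by (simp add: perm_span_map_def Let_def func_space_simps)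
  show "perm_span_map K X Y T a \<in> extensional (pts X)" if "a \<in> perm_space Y" for a
    using perm_span_map_closed[OF T X Y that] by (simp add: PiE_def)
qed

text \<open>The choice made in \<open>perm_map\<close> is harmless: the class is nonempty, so the
  chosen span is isomorphic to \<open>S\<close>, and isomorphic spans induce the same map.\<close>

lemma perm_map_span_class:
  fixes S :: "('c, 's, 'x) gspan"
  assumes "infinite (UNIV :: 'x set)" and S: "S \<in> spans G X Y"
    and X: "finite_gset G X" and Y: "finite_gset G Y"
  shows "perm_map K X Y (span_class G X Y S) = perm_span_map K X Y S"
proof -
  define T where "T = (SOME T. T \<in> span_class G X Y S)"
  have "T \<in> span_class G X Y S"
    using G.span_class_nonempty[OF assms(1) S] unfolding T_def by (rule some_in_eq[THEN iffD2])
  then have "T \<in> spans G X Y" "span_iso G T S" by (simp_all add: span_class_def)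
  then show ?thesis
    using perm_span_map_iso[OF _ S _ X Y] by (simp add: perm_map_def T_def)
qed

lemma perm_span_map_id:
  assumes X: "finite_gset G X"
  shows "perm_span_map K X X (id_span X) = (\<lambda>a \<in> perm_space X. a)"
proof (rule perm_span_map_eqI[OF G.id_span_in_spans[OF X] X X])
  fix a x assume a: "a \<in> perm_space X" and x: "x \<in> pts X"
  have "{s \<in> pts (apex (id_span X)). lleg (id_span X) s = x} = {x}"
    using x by (auto simp: id_span_def)
  moreover have "a x \<in> carrier K" using a x by auto
  ultimately show "(\<lambda>a \<in> perm_space X. a) a x
      = (\<Oplus>s\<in>{s \<in> pts (apex (id_span X)). lleg (id_span X) s = x}. a (rleg (id_span X) s))"
    using a x by (simp add: id_span_def)
qed (auto simp: PiE_def)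

text \<open>Sort the left fibre of the pullback over \<open>x\<close> by first components. Over
  \<open>s\<close> lie the pairs \<open>(s, t)\<close> with \<open>lleg T t = rleg S s\<close>, and
  these \<open>t\<close> form the left fibre over which the map of \<open>T\<close> sums at the
  coordinate \<open>rleg S s\<close>. The order of composition shows the contravariance of
  \<open>k_*\<close>.\<close>

lemma perm_span_map_pullback:
  assumes S: "S \<in> spans G X Y" and T: "T \<in> spans G Y Z"
    and X: "finite_gset G X" and Y: "finite_gset G Y" and Z: "finite_gset G Z"
  shows "perm_span_map K X Z (pullback_span S T)
    = compose (perm_space Z) (perm_span_map K X Y S) (perm_span_map K Y Z T)"
proof (rule perm_span_map_eqI[OF G.pullback_span_in_spans[OF S T] X Z])
  fix a x assume a: "a \<in> perm_space Z" and x: "x \<in> pts X"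
  let ?P = "pts (apex (pullback_span S T))"
  let ?A = "{p \<in> ?P. lleg (pullback_span S T) p = x}"
  let ?B = "{s \<in> pts (apex S). lleg S s = x}"
  note b = perm_span_map_closed[OF T Y Z a]
  note PQ = G.pullback_span_in_spans[OF S T]
  have closed: "t \<in> pts (apex T) \<Longrightarrow> a (rleg T t) \<in> carrier K" for t
    using G.spans_rleg(1)[OF T] a by auto
  have "perm_span_map K X Y S (perm_span_map K Y Z T a) x
    = (\<Oplus>s\<in>?B. perm_span_map K Y Z T a (rleg S s))"
    by (rule perm_span_map_apply[OF S X Y b x])
  also have "\<dots> = (\<Oplus>s\<in>?B. \<Oplus>p\<in>{p \<in> ?A. fst p = s}. a (rleg (pullback_span S T) p))"
  proof (rule finsum_cong')
    fix s assume s: "s \<in> ?B"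
    have fib: "bij_betw (Pair s) {t \<in> pts (apex T). lleg T t = rleg S s} {p \<in> ?A. fst p = s}"
      using s by (intro bij_betw_byWitness[where f' = snd])
        (auto simp: G.pullback_span_simps)
    have "perm_span_map K Y Z T a (rleg S s)
      = (\<Oplus>t\<in>{t \<in> pts (apex T). lleg T t = rleg S s}. a (rleg T t))"
      using s G.spans_rleg(1)[OF S] by (intro perm_span_map_apply[OF T Y Z a]) auto
    also have "\<dots> = (\<Oplus>t\<in>{t \<in> pts (apex T). lleg T t = rleg S s}.
        a (rleg (pullback_span S T) (s, t)))"
      using s closed by (intro finsum_cong') (auto simp: G.pullback_span_simps)
    also have "\<dots> = (\<Oplus>p\<in>{p \<in> ?A. fst p = s}. a (rleg (pullback_span S T) p))"
      using fib closed by (intro finsum_reindex_bij_betw) (auto simp: G.pullback_span_simps)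
    finally show "perm_span_map K Y Z T a (rleg S s)
      = (\<Oplus>p\<in>{p \<in> ?A. fst p = s}. a (rleg (pullback_span S T) p))" .
  qed (use closed in \<open>auto intro!: finsum_closed simp: G.pullback_span_simps\<close>)
  also have "\<dots> = (\<Oplus>p\<in>?A. a (rleg (pullback_span S T) p))"
    using closed G.spans_finite[OF PQ] G.spans_finite[OF S]
    by (intro finsum_fibres) (auto simp: G.pullback_span_simps)
  finally show "compose (perm_space Z) (perm_span_map K X Y S) (perm_span_map K Y Z T) a x
      = (\<Oplus>p\<in>?A. a (rleg (pullback_span S T) p))"
    using a by (simp add: compose_def)
next
  show "compose (perm_space Z) (perm_span_map K X Y S) (perm_span_map K Y Z T) a
      \<in> extensional (pts X)" if "a \<in> perm_space Z" for a
    using perm_span_map_closed[OF S X Y perm_span_map_closed[OF T Y Z that]] that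
    by (simp add: compose_def PiE_def)
qed simp

text \<open>The left fibre of the sum over \<open>x\<close> is the disjoint union of the left fibres
  of \<open>S\<close> and \<open>T\<close>, so the coordinate sum splits.\<close>

lemma perm_span_map_sum:
  assumes S: "S \<in> spans G X Y" and T: "T \<in> spans G X Y"
    and X: "finite_gset G X" and Y: "finite_gset G Y"
  shows "perm_span_map K X Y (sum_span S T)
    = (\<lambda>a \<in> perm_space Y. \<lambda>x \<in> pts X. perm_span_map K X Y S a x \<oplus> perm_span_map K X Y T a x)"
proof (rule perm_span_map_eqI[OF G.sum_span_in_spans[OF S T] X Y])
  fix a x assume a: "a \<in> perm_space Y" and x: "x \<in> pts X"
  let ?A = "{s \<in> pts (apex S). lleg S s = x}" and ?B = "{t \<in> pts (apex T). lleg T t = x}"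
  let ?r = "rleg (sum_span S T)"
  have closed: "s \<in> pts (apex S) \<Longrightarrow> a (rleg S s) \<in> carrier K"
    "t \<in> pts (apex T) \<Longrightarrow> a (rleg T t) \<in> carrier K" for s t
    using G.spans_rleg(1)[OF S] G.spans_rleg(1)[OF T] a by auto
  have "{p \<in> pts (apex (sum_span S T)). lleg (sum_span S T) p = x} = Inl ` ?A \<union> Inr ` ?B"
    by (auto simp: G.sum_span_simps)
  then have "(\<Oplus>p\<in>{p \<in> pts (apex (sum_span S T)). lleg (sum_span S T) p = x}. a (?r p))
    = (\<Oplus>p\<in>Inl ` ?A. a (?r p)) \<oplus> (\<Oplus>p\<in>Inr ` ?B. a (?r p))"
    using closed G.spans_finite[OF S] G.spans_finite[OF T]
    by (simp only:) (rule finsum_Un_disjoint, auto simp: G.sum_span_simps)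
  also have "(\<Oplus>p\<in>Inl ` ?A. a (?r p)) = (\<Oplus>s\<in>?A. a (?r (Inl s)))"
    using closed by (intro finsum_reindex) (auto simp: G.sum_span_simps)
  also have "\<dots> = (\<Oplus>s\<in>?A. a (rleg S s))"
    using closed by (intro finsum_cong') (auto simp: G.sum_span_simps)
  also have "(\<Oplus>p\<in>Inr ` ?B. a (?r p)) = (\<Oplus>t\<in>?B. a (?r (Inr t)))"
    using closed by (intro finsum_reindex) (auto simp: G.sum_span_simps)
  also have "\<dots> = (\<Oplus>t\<in>?B. a (rleg T t))"
    using closed by (intro finsum_cong') (auto simp: G.sum_span_simps)
  finally show "(\<lambda>a \<in> perm_space Y. \<lambda>x \<in> pts X.
      perm_span_map K X Y S a x \<oplus> perm_span_map K X Y T a x) a x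
    = (\<Oplus>p\<in>{p \<in> pts (apex (sum_span S T)). lleg (sum_span S T) p = x}. a (?r p))"
    using a x perm_span_map_apply[OF S X Y a x] perm_span_map_apply[OF T X Y a x] by simp
qed simp_all

lemma perm_rep_module: "module K (space (perm_rep K G X))"
  by (simp add: perm_rep_simps func_space_is_module)

lemma perm_rep_ract_closed:
  assumes "finite_gset G X" "g \<in> carrier G" "a \<in> carrier (space (perm_rep K G X))"
  shows "ract (perm_rep K G X) g a \<in> carrier (space (perm_rep K G X))"
  using assms by (auto simp: perm_rep_simps func_space_simps)

lemma perm_span_map_rep_hom:
  assumes S: "S \<in> spans G X Y" and X: "finite_gset G X" and Y: "finite_gset G Y"
  shows "perm_span_map K X Y S \<in> rep_hom K G (perm_rep K G Y) (perm_rep K G X)"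
proof (intro rep_homI linear_mapsI; unfold perm_rep_simps(1) func_space_simps(1))
  note apply_S = perm_span_map_apply[OF S X Y]
  note closed_S = perm_span_map_closed[OF S X Y]
  interpret FX: module K "func_space (pts X)" by (rule func_space_is_module)
  interpret FY: module K "func_space (pts Y)" by (rule func_space_is_module)
  have closed: "s \<in> pts (apex S) \<Longrightarrow> a (rleg S s) \<in> carrier K" if "a \<in> perm_space Y" for a s
    using G.spans_rleg(1)[OF S] that by auto
  show "perm_span_map K X Y S \<in> extensional (perm_space Y)"
    by (simp add: perm_span_map_def Let_def func_space_simps)
  show "perm_span_map K X Y S a \<in> perm_space X" if "a \<in> perm_space Y" for a
    by (rule closed_S[OF that])
  show "perm_span_map K X Y S (a \<oplus>\<^bsub>func_space (pts Y)\<^esub> b)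
      = perm_span_map K X Y S a \<oplus>\<^bsub>func_space (pts X)\<^esub> perm_span_map K X Y S b"
    if a: "a \<in> perm_space Y" and b: "b \<in> perm_space Y" for a b
  proof (rule extensionalityI[of _ "pts X"])
    have ab: "a \<oplus>\<^bsub>func_space (pts Y)\<^esub> b \<in> perm_space Y"
      using a b by (auto simp: func_space_simps)
    show "perm_span_map K X Y S (a \<oplus>\<^bsub>func_space (pts Y)\<^esub> b) \<in> extensional (pts X)"
      using closed_S[OF ab] by (simp add: PiE_def)
    fix x assume x: "x \<in> pts X"
    let ?A = "{s \<in> pts (apex S). lleg S s = x}"
    have "(\<Oplus>s\<in>?A. (a \<oplus>\<^bsub>func_space (pts Y)\<^esub> b) (rleg S s))
      = (\<Oplus>s\<in>?A. a (rleg S s) \<oplus> b (rleg S s))"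
      using closed[OF a] closed[OF b] G.spans_rleg(1)[OF S]
      by (intro finsum_cong') (auto simp: func_space_simps)
    also have "\<dots> = (\<Oplus>s\<in>?A. a (rleg S s)) \<oplus> (\<Oplus>s\<in>?A. b (rleg S s))"
      using closed[OF a] closed[OF b] by (intro finsum_addf) auto
    finally show "perm_span_map K X Y S (a \<oplus>\<^bsub>func_space (pts Y)\<^esub> b) x
        = (perm_span_map K X Y S a \<oplus>\<^bsub>func_space (pts X)\<^esub> perm_span_map K X Y S b) x"
      using x apply_S[OF ab x] apply_S[OF a x] apply_S[OF b x] by (simp add: func_space_simps(2))
  qed (simp add: func_space_simps)
  show "perm_span_map K X Y S (c \<odot>\<^bsub>func_space (pts Y)\<^esub> a)
      = c \<odot>\<^bsub>func_space (pts X)\<^esub> perm_span_map K X Y S a"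
    if c: "c \<in> carrier K" and a: "a \<in> perm_space Y" for c a
  proof (rule extensionalityI[of _ "pts X"])
    have ca: "c \<odot>\<^bsub>func_space (pts Y)\<^esub> a \<in> perm_space Y"
      using a c by (auto simp: func_space_simps)
    show "perm_span_map K X Y S (c \<odot>\<^bsub>func_space (pts Y)\<^esub> a) \<in> extensional (pts X)"
      using closed_S[OF ca] by (simp add: PiE_def)
    fix x assume x: "x \<in> pts X"
    let ?A = "{s \<in> pts (apex S). lleg S s = x}"
    have "(\<Oplus>s\<in>?A. (c \<odot>\<^bsub>func_space (pts Y)\<^esub> a) (rleg S s)) = (\<Oplus>s\<in>?A. c \<otimes> a (rleg S s))"
      using closed[OF a] c G.spans_rleg(1)[OF S]
      by (intro finsum_cong') (auto simp: func_space_simps)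
    also have "\<dots> = c \<otimes> (\<Oplus>s\<in>?A. a (rleg S s))"
      using closed[OF a] c G.spans_finite[OF S] by (intro finsum_rdistr[symmetric]) auto
    finally show "perm_span_map K X Y S (c \<odot>\<^bsub>func_space (pts Y)\<^esub> a) x
        = (c \<odot>\<^bsub>func_space (pts X)\<^esub> perm_span_map K X Y S a) x"
      using x apply_S[OF ca x] apply_S[OF a x] by (simp add: func_space_simps(3))
  qed (simp add: func_space_simps)
  show "perm_span_map K X Y S (ract (perm_rep K G Y) g a)
      = ract (perm_rep K G X) g (perm_span_map K X Y S a)"
    if g: "g \<in> carrier G" and a: "a \<in> perm_space Y" for g a
  proof (rule extensionalityI[of _ "pts X"])
    have ga: "ract (perm_rep K G Y) g a \<in> perm_space Y"
      using perm_rep_ract_closed[OF Y g, of a] a by (simp add: perm_rep_simps(1) func_space_simps)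
    show "perm_span_map K X Y S (ract (perm_rep K G Y) g a) \<in> extensional (pts X)"
      using closed_S[OF ga] by (simp add: PiE_def)
    show "ract (perm_rep K G X) g (perm_span_map K X Y S a) \<in> extensional (pts X)"
      using closed_S[OF a] by (simp add: perm_rep_simps)
    fix x assume x: "x \<in> pts X"
    let ?g = "inv\<^bsub>G\<^esub> g"
    have gx: "gact X ?g x \<in> pts X" using X g x by simp
    \<comment> \<open>Functions are translated by precomposing with the action of the inverse of
      \<open>g\<close>. That inverse moves the left fibre over \<open>x\<close> onto the left fibre
      over the translated point, and this reindexing is the equivariance.\<close>
    have bij: "bij_betw (gact (apex S) ?g) {s \<in> pts (apex S). lleg S s = x}
        {s \<in> pts (apex S). lleg S s = gact X ?g x}"
      using S G.spans_apex[OF S] X g x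
      by (intro bij_betw_byWitness[where f' = "gact (apex S) g"]) auto
    have "(\<Oplus>s\<in>{s \<in> pts (apex S). lleg S s = x}. ract (perm_rep K G Y) g a (rleg S s))
      = (\<Oplus>s\<in>{s \<in> pts (apex S). lleg S s = x}. a (rleg S (gact (apex S) ?g s)))"
      using S g a G.gact_closed[OF Y] by (intro finsum_cong') (auto simp: perm_rep_simps
          intro!: PiE_mem[OF a])
    also have "\<dots> = (\<Oplus>s\<in>{s \<in> pts (apex S). lleg S s = gact X ?g x}. a (rleg S s))"
      using closed[OF a] by (intro finsum_reindex_bij_betw bij) auto
    finally show "perm_span_map K X Y S (ract (perm_rep K G Y) g a) x
        = ract (perm_rep K G X) g (perm_span_map K X Y S a) x"
      using x apply_S[OF ga x] apply_S[OF a gx] closed_S[OF a] by (simp add: perm_rep_simps)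
  qed
qed

end

section \<open>Spaces of homomorphisms and composition as a linear operation on them\<close>

lemma hom_space_simps:
  "carrier (hom_space K G Q R) = rep_hom K G Q R"
  "e \<oplus>\<^bsub>hom_space K G Q R\<^esub> f = (\<lambda>v \<in> carrier (space Q). e v \<oplus>\<^bsub>space R\<^esub> f v)"
  "c \<odot>\<^bsub>hom_space K G Q R\<^esub> f = (\<lambda>v \<in> carrier (space Q). c \<odot>\<^bsub>space R\<^esub> f v)"
  "\<zero>\<^bsub>hom_space K G Q R\<^esub> = (\<lambda>v \<in> carrier (space Q). \<zero>\<^bsub>space R\<^esub>)"
  by (simp_all add: hom_space_def)

lemma rep_hom_closed: "f \<in> rep_hom K G Q R \<Longrightarrow> v \<in> carrier (space Q) \<Longrightarrow> f v \<in> carrier (space R)"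
  by (rule linear_maps_closed[OF rep_hom_linear])

lemma rep_hom_zero:
  assumes Q: "module K (space Q)" and R: "representation K G R"
    and ract: "\<And>g v. g \<in> carrier G \<Longrightarrow> v \<in> carrier (space Q) \<Longrightarrow> ract Q g v \<in> carrier (space Q)"
  shows "(\<lambda>v \<in> carrier (space Q). \<zero>\<^bsub>space R\<^esub>) \<in> rep_hom K G Q R"
proof -
  interpret Q: module K "space Q" by (rule Q)
  interpret R: module K "space R" by (rule representation_module[OF R])
  show ?thesis
    by (intro rep_homI linear_mapsI)
      (auto simp: ract linear_maps_zero[OF R.module_axioms R.module_axioms representation_ract[OF R]])
qed

lemma rep_hom_add:
  assumes Q: "module K (space Q)" and R: "representation K G R"
    and ract: "\<And>g v. g \<in> carrier G \<Longrightarrow> v \<in> carrier (space Q) \<Longrightarrow> ract Q g v \<in> carrier (space Q)"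
    and e: "e \<in> rep_hom K G Q R" and f: "f \<in> rep_hom K G Q R"
  shows "(\<lambda>v \<in> carrier (space Q). e v \<oplus>\<^bsub>space R\<^esub> f v) \<in> rep_hom K G Q R"
proof -
  interpret Q: module K "space Q" by (rule Q)
  interpret R: module K "space R" by (rule representation_module[OF R])
  note ef = rep_hom_closed[OF e] rep_hom_closed[OF f]
  show ?thesis
    by (intro rep_homI linear_mapsI)
      (auto simp: ract ef linear_maps_add[OF rep_hom_linear[OF e]] linear_maps_add[OF rep_hom_linear[OF f]]
        linear_maps_smult[OF rep_hom_linear[OF e]] linear_maps_smult[OF rep_hom_linear[OF f]]
        rep_hom_equivariant[OF e] rep_hom_equivariant[OF f] R.smult_r_distr R.M.add.m_ac
        linear_maps_add[OF representation_ract[OF R]])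
qed

text \<open>Linearity of the multiple rests on commutativity of the scalars, since \<open>c\<close>
  has to be exchanged with the scalar pulled out of \<open>f\<close>.\<close>

lemma rep_hom_smult:
  assumes Q: "module K (space Q)" and R: "representation K G R"
    and ract: "\<And>g v. g \<in> carrier G \<Longrightarrow> v \<in> carrier (space Q) \<Longrightarrow> ract Q g v \<in> carrier (space Q)"
    and c: "c \<in> carrier K" and f: "f \<in> rep_hom K G Q R"
  shows "(\<lambda>v \<in> carrier (space Q). c \<odot>\<^bsub>space R\<^esub> f v) \<in> rep_hom K G Q R"
proof -
  interpret Q: module K "space Q" by (rule Q)
  interpret R: module K "space R" by (rule representation_module[OF R])
  show ?thesis
    by (intro rep_homI linear_mapsI)
      (auto simp: c ract rep_hom_closed[OF f] linear_maps_add[OF rep_hom_linear[OF f]]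
        linear_maps_smult[OF rep_hom_linear[OF f]] rep_hom_equivariant[OF f] R.smult_r_distr
        R.smult_assoc1[symmetric] Q.m_comm linear_maps_smult[OF representation_ract[OF R]])
qed

lemma hom_space_vectorspace:
  assumes K: "field K" and Q: "module K (space Q)" and R: "representation K G R"
    and ract: "\<And>g v. g \<in> carrier G \<Longrightarrow> v \<in> carrier (space Q) \<Longrightarrow> ract Q g v \<in> carrier (space Q)"
  shows "vectorspace K (hom_space K G Q R)"
proof -
  interpret field K by (rule K)
  interpret Q: module K "space Q" by (rule Q)
  interpret R: module K "space R" by (rule representation_module[OF R])
  note add = rep_hom_add[OF Q R ract] and smult = rep_hom_smult[OF Q R ract]
    and zero = rep_hom_zero[OF Q R ract]
  have ext: "f \<in> extensional (carrier (space Q))" if "f \<in> rep_hom K G Q R" for f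
    by (rule linear_maps_extensional[OF rep_hom_linear[OF that]])
  have "module K (hom_space K G Q R)"
  proof (rule module_criteria)
    show "\<forall>f\<in>carrier (hom_space K G Q R). \<exists>e\<in>carrier (hom_space K G Q R).
        f \<oplus>\<^bsub>hom_space K G Q R\<^esub> e = \<zero>\<^bsub>hom_space K G Q R\<^esub>"
    proof
      fix f assume "f \<in> carrier (hom_space K G Q R)"
      then have f: "f \<in> rep_hom K G Q R" by (simp add: hom_space_simps)
      \<comment> \<open>The additive inverse is taken as the multiple of \<open>f\<close> by minus
        one, which is a homomorphism by closure under scalars.\<close>
      let ?e = "\<lambda>v \<in> carrier (space Q). \<ominus>\<^bsub>K\<^esub> \<one>\<^bsub>K\<^esub> \<odot>\<^bsub>space R\<^esub> f v"
      have "?e \<in> rep_hom K G Q R" by (rule smult) (simp_all add: f)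
      moreover have "f \<oplus>\<^bsub>hom_space K G Q R\<^esub> ?e = \<zero>\<^bsub>hom_space K G Q R\<^esub>"
        unfolding hom_space_simps
        by (rule restrict_ext) (simp add: rep_hom_closed[OF f] R.smult_l_minus R.M.r_neg)
      ultimately show "\<exists>e\<in>carrier (hom_space K G Q R).
          f \<oplus>\<^bsub>hom_space K G Q R\<^esub> e = \<zero>\<^bsub>hom_space K G Q R\<^esub>"
        unfolding hom_space_simps(1) by blast
    qed
    show "cring K" by (rule is_cring)
  qed (auto simp: hom_space_simps zero add smult rep_hom_closed R.M.add.m_ac R.smult_assoc1
      R.smult_l_distr R.smult_r_distr intro!: extensionalityI[of _ "carrier (space Q)"] dest: ext)
  then show ?thesis by (simp add: vectorspace_def K)
qed

text \<open>With \<open>e\<close> the map induced by a span, this is the effect of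
  Rep(\<open>k_*\<close>-, R) on that arrow. The premise on the hom space keeps sums and multiples
  in \<open>rep_hom\<close>, where the restricted function can be unfolded.\<close>

lemma precompose_linear:
  assumes P: "module K (space P)"
    and ract: "\<And>g v. g \<in> carrier G \<Longrightarrow> v \<in> carrier (space P) \<Longrightarrow> ract P g v \<in> carrier (space P)"
    and H: "module K (hom_space K G Q R)" and e: "e \<in> rep_hom K G P Q"
  shows "(\<lambda>f \<in> rep_hom K G Q R. compose (carrier (space P)) f e)
    \<in> linear_maps K (hom_space K G Q R) (hom_space K G P R)"
proof (rule linear_mapsI)
  fix f assume f: "f \<in> carrier (hom_space K G Q R)"
  show "(\<lambda>f \<in> rep_hom K G Q R. compose (carrier (space P)) f e) f \<in> carrier (hom_space K G P R)"
    using f rep_hom_compose[OF P ract e] by (simp add: hom_space_simps)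
next
  interpret H: module K "hom_space K G Q R" by (rule H)
  fix f f' assume f: "f \<in> carrier (hom_space K G Q R)" and f': "f' \<in> carrier (hom_space K G Q R)"
  have "f \<oplus>\<^bsub>hom_space K G Q R\<^esub> f' \<in> rep_hom K G Q R"
    using H.a_closed[OF f f'] by (simp add: hom_space_simps)
  then show "(\<lambda>f \<in> rep_hom K G Q R. compose (carrier (space P)) f e) (f \<oplus>\<^bsub>hom_space K G Q R\<^esub> f')
    = (\<lambda>f \<in> rep_hom K G Q R. compose (carrier (space P)) f e) f
      \<oplus>\<^bsub>hom_space K G P R\<^esub> (\<lambda>f \<in> rep_hom K G Q R. compose (carrier (space P)) f e) f'"
    using f f' by (auto simp: hom_space_simps compose_def rep_hom_closed[OF e])
next
  interpret H: module K "hom_space K G Q R" by (rule H)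
  fix c f assume c: "c \<in> carrier K" and f: "f \<in> carrier (hom_space K G Q R)"
  have "c \<odot>\<^bsub>hom_space K G Q R\<^esub> f \<in> rep_hom K G Q R"
    using H.smult_closed[OF c f] by (simp add: hom_space_simps)
  then show "(\<lambda>f \<in> rep_hom K G Q R. compose (carrier (space P)) f e) (c \<odot>\<^bsub>hom_space K G Q R\<^esub> f)
    = c \<odot>\<^bsub>hom_space K G P R\<^esub> (\<lambda>f \<in> rep_hom K G Q R. compose (carrier (space P)) f e) f"
    using f by (auto simp: hom_space_simps compose_def rep_hom_closed[OF e])
qed (simp add: hom_space_simps)

text \<open>For \<open>P\<close> the permutation representation of \<open>X\<close>, this is the
  component at \<open>X\<close> of the transformation that \<open>ktilde\<close> assigns to
  \<open>f\<close>.\<close>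

lemma postcompose_linear:
  assumes P: "module K (space P)"
    and ract: "\<And>g v. g \<in> carrier G \<Longrightarrow> v \<in> carrier (space P) \<Longrightarrow> ract P g v \<in> carrier (space P)"
    and H: "module K (hom_space K G P Q)" and f: "f \<in> rep_hom K G Q R"
  shows "(\<lambda>e \<in> rep_hom K G P Q. compose (carrier (space P)) f e)
    \<in> linear_maps K (hom_space K G P Q) (hom_space K G P R)"
proof (rule linear_mapsI)
  fix e assume e: "e \<in> carrier (hom_space K G P Q)"
  show "(\<lambda>e \<in> rep_hom K G P Q. compose (carrier (space P)) f e) e \<in> carrier (hom_space K G P R)"
    using e rep_hom_compose[OF P ract _ f] by (simp add: hom_space_simps)
next
  interpret H: module K "hom_space K G P Q" by (rule H)
  fix e e' assume e: "e \<in> carrier (hom_space K G P Q)" and e': "e' \<in> carrier (hom_space K G P Q)"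
  have "e \<oplus>\<^bsub>hom_space K G P Q\<^esub> e' \<in> rep_hom K G P Q"
    using H.a_closed[OF e e'] by (simp add: hom_space_simps)
  then show "(\<lambda>e \<in> rep_hom K G P Q. compose (carrier (space P)) f e) (e \<oplus>\<^bsub>hom_space K G P Q\<^esub> e')
    = (\<lambda>e \<in> rep_hom K G P Q. compose (carrier (space P)) f e) e
      \<oplus>\<^bsub>hom_space K G P R\<^esub> (\<lambda>e \<in> rep_hom K G P Q. compose (carrier (space P)) f e) e'"
    using e e' by (auto simp: hom_space_simps compose_def rep_hom_closed linear_maps_add[OF rep_hom_linear[OF f]])
next
  interpret H: module K "hom_space K G P Q" by (rule H)
  fix c e assume c: "c \<in> carrier K" and e: "e \<in> carrier (hom_space K G P Q)"
  have "c \<odot>\<^bsub>hom_space K G P Q\<^esub> e \<in> rep_hom K G P Q"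
    using H.smult_closed[OF c e] by (simp add: hom_space_simps)
  then show "(\<lambda>e \<in> rep_hom K G P Q. compose (carrier (space P)) f e) (c \<odot>\<^bsub>hom_space K G P Q\<^esub> e)
    = c \<odot>\<^bsub>hom_space K G P R\<^esub> (\<lambda>e \<in> rep_hom K G P Q. compose (carrier (space P)) f e) e"
    using e c by (auto simp: hom_space_simps compose_def rep_hom_closed linear_maps_smult[OF rep_hom_linear[OF f]])
qed (simp add: hom_space_simps)

text \<open>\<open>e\<close> takes values in the carrier of \<open>Q\<close>, so the restriction
  inside the inner composite on the right is never seen. Both functoriality statements and
  naturality rest on this associativity.\<close>

lemma rep_hom_compose_assoc:
  assumes "e \<in> rep_hom K G P Q"
  shows "compose (carrier (space P)) h (compose (carrier (space P)) f e)
    = compose (carrier (space P)) (compose (carrier (space Q)) h f) e"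
  using rep_hom_closed[OF assms] by (auto simp: compose_def)

section \<open>Functoriality of \<open>k_*\<close> and of \<open>ktilde\<close>\<close>

context perm_functor
begin

lemma Obj_Spn: "X \<in> Obj (Spn G) \<longleftrightarrow> finite_gset G X"
  by (simp add: Spn_def)

lemma ktilde_obj_simps:
  "fobj (ktilde_obj K G R) X = hom_space K G (perm_rep K G X) R"
  "fmap (ktilde_obj K G R) X Y A = (\<lambda>f \<in> rep_hom K G (perm_rep K G X) R.
       compose (carrier (space (perm_rep K G Y))) f (perm_map K X Y A))"
  by (simp_all add: ktilde_obj_def)

lemma perm_hom_space_vectorspace:
  assumes "representation K G R" and "X \<in> Obj (Spn G)"
  shows "vectorspace K (hom_space K G (perm_rep K G X) R)"
  using assms unfolding Obj_Spn
  by (intro hom_space_vectorspace perm_rep_module perm_rep_ract_closed field_axioms)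

lemma ktilde_simps:
  "fobj (ktilde K G) R = ktilde_obj K G R"
  "fmap (ktilde K G) Q R f = (\<lambda>X \<in> Obj (Spn G). \<lambda>e \<in> rep_hom K G (perm_rep K G X) Q.
       compose (carrier (space (perm_rep K G X))) f e)"
  by (simp_all add: ktilde_def)

context
  assumes inf: "infinite (UNIV :: 'x set)"
begin

lemma perm_map_rep_hom:
  fixes X Y :: "('c, 'x) gset"
  assumes X: "X \<in> Obj (Spn G)" and Y: "Y \<in> Obj (Spn G)" and A: "A \<in> Hom (Spn G) X Y"
  shows "perm_map K X Y A \<in> rep_hom K G (perm_rep K G Y) (perm_rep K G X)"
proof -
  from A obtain S :: "('c, 'x, 'x) gspan" where S: "S \<in> spans G X Y"
    and "A = span_class G X Y S" by (rule G.Hom_SpnE)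
  with X Y show ?thesis
    by (simp add: Obj_Spn perm_map_span_class[OF inf S] perm_span_map_rep_hom)
qed

lemma perm_map_Ident:
  fixes X :: "('c, 'x) gset"
  assumes "X \<in> Obj (Spn G)"
  shows "perm_map K X X (Ident (Spn G) X) = (\<lambda>a \<in> carrier (space (perm_rep K G X)). a)"
  using assms perm_map_span_class[OF inf G.id_span_in_spans] perm_span_map_id
  by (simp add: Obj_Spn) (simp add: Spn_def perm_rep_simps func_space_simps)

lemma perm_map_Cmp:
  fixes X Y Z :: "('c, 'x) gset"
  assumes X: "X \<in> Obj (Spn G)" and Y: "Y \<in> Obj (Spn G)" and Z: "Z \<in> Obj (Spn G)"
    and A: "A \<in> Hom (Spn G) X Y" and B: "B \<in> Hom (Spn G) Y Z"
  shows "perm_map K X Z (Cmp (Spn G) X Y Z B A)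
    = compose (carrier (space (perm_rep K G Z))) (perm_map K X Y A) (perm_map K Y Z B)"
proof -
  from A obtain S :: "('c, 'x, 'x) gspan" where S: "S \<in> spans G X Y"
    and A': "A = span_class G X Y S" by (rule G.Hom_SpnE)
  from B obtain T :: "('c, 'x, 'x) gspan" where T: "T \<in> spans G Y Z"
    and B': "B = span_class G Y Z T" by (rule G.Hom_SpnE)
  note objs = X[unfolded Obj_Spn] Y[unfolded Obj_Spn] Z[unfolded Obj_Spn]
  show ?thesis
    unfolding A' B' G.Cmp_span_class[OF inf S T]
      perm_map_span_class[OF inf S objs(1,2)] perm_map_span_class[OF inf T objs(2,3)]
      perm_map_span_class[OF inf G.pullback_span_in_spans[OF S T] objs(1,3)]
      perm_span_map_pullback[OF S T objs] perm_rep_simps(1) func_space_simps(1) ..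
qed

lemma perm_map_Add:
  fixes X Y :: "('c, 'x) gset"
  assumes X: "X \<in> Obj (Spn G)" and Y: "Y \<in> Obj (Spn G)"
    and A: "A \<in> Hom (Spn G) X Y" and B: "B \<in> Hom (Spn G) X Y"
  shows "perm_map K X Y (Add (Spn G) X Y A B)
    = (\<lambda>a \<in> carrier (space (perm_rep K G Y)).
        perm_map K X Y A a \<oplus>\<^bsub>space (perm_rep K G X)\<^esub> perm_map K X Y B a)"
proof -
  from A obtain S :: "('c, 'x, 'x) gspan" where S: "S \<in> spans G X Y"
    and A': "A = span_class G X Y S" by (rule G.Hom_SpnE)
  from B obtain T :: "('c, 'x, 'x) gspan" where T: "T \<in> spans G X Y"
    and B': "B = span_class G X Y T" by (rule G.Hom_SpnE)
  note objs = X[unfolded Obj_Spn] Y[unfolded Obj_Spn]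
  show ?thesis
    unfolding A' B' G.Add_span_class[OF inf S T]
      perm_map_span_class[OF inf S objs] perm_map_span_class[OF inf T objs]
      perm_map_span_class[OF inf G.sum_span_in_spans[OF S T] objs]
      perm_span_map_sum[OF S T objs] perm_rep_simps(1) func_space_simps ..
qed

text \<open>The null arrow consists of the spans with empty apex, so whichever one is chosen has
  empty left fibres and every coordinate is an empty sum.\<close>

lemma perm_map_Null:
  fixes X Y :: "('c, 'x) gset"
  assumes X: "X \<in> Obj (Spn G)" and Y: "Y \<in> Obj (Spn G)"
  shows "perm_map K X Y (Null (Spn G) X Y)
    = (\<lambda>a \<in> carrier (space (perm_rep K G Y)). \<zero>\<^bsub>space (perm_rep K G X)\<^esub>)"
proof -
  \<comment> \<open>The empty span, showing that there is something to choose.\<close>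
  let ?E = "\<lparr>lleg = (\<lambda>x \<in> {}. undefined), apex = \<lparr>pts = {}, gact = (\<lambda>g. \<lambda>x \<in> {}. undefined)\<rparr>,
    rleg = (\<lambda>x \<in> {}. undefined)\<rparr> :: ('c, 'x, 'x) gspan"
  have "?E \<in> spans G X Y"
    unfolding spans_def by (auto intro!: G.finite_gsetI G.gmapsI)
  then have "?E \<in> Null (Spn G) X Y" by (simp add: Spn_def)
  then have "(SOME S. S \<in> Null (Spn G) X Y) \<in> Null (Spn G) X Y" by (rule someI)
  then obtain S :: "('c, 'x, 'x) gspan" where S: "S \<in> spans G X Y" and "pts (apex S) = {}"
    and "S = (SOME S. S \<in> Null (Spn G) X Y)"
    by (auto simp: Spn_def)
  with perm_span_map_eqI[OF S X[unfolded Obj_Spn] Y[unfolded Obj_Spn],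
      of "\<lambda>a \<in> perm_space Y. \<lambda>x \<in> pts X. \<zero>"]
  show ?thesis by (simp add: perm_map_def perm_rep_simps(1) func_space_simps)
qed

text \<open>Two contravariant functors, \<open>k_*\<close> and Rep(-, R), compose to a covariant
  one. Sums and null arrows are preserved because every homomorphism that is precomposed is itself
  additive and sends zero to zero.\<close>

lemma additive_functor_ktilde_obj:
  assumes R: "representation K G R"
  shows "additive_functor (Spn G) (Vect K)
    (ktilde_obj K G R :: ('c, 'a, 'x, ('x \<Rightarrow> 'a) \<Rightarrow> 'v) mackey)" (is "additive_functor ?C ?D ?F")
proof -
  interpret C: category ?C by (rule G.category_Spn[OF inf])
  interpret D: category ?D by (rule category_Vect)
  have ract: "ract (perm_rep K G X) g a \<in> carrier (space (perm_rep K G X))"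
    if "X \<in> Obj ?C" "g \<in> carrier G" "a \<in> carrier (space (perm_rep K G X))" for X g a
    using perm_rep_ract_closed that by (simp add: Obj_Spn)
  have comp: "compose (carrier (space (perm_rep K G Y))) f (perm_map K X Y A)
      \<in> rep_hom K G (perm_rep K G Y) R"
    if "X \<in> Obj ?C" "Y \<in> Obj ?C" "A \<in> Hom ?C X Y" "f \<in> rep_hom K G (perm_rep K G X) R"
    for X Y A f
    by (rule rep_hom_compose[OF perm_rep_module ract[OF that(2)] perm_map_rep_hom[OF that(1-3)] that(4)])
  show ?thesis
  proof
    fix X Y Z :: "('c, 'x) gset" and A B
    show "X \<in> Obj ?C \<Longrightarrow> fobj ?F X \<in> Obj ?D"
      using perm_hom_space_vectorspace[OF R] by (simp add: ktilde_obj_simps) (simp add: Vect_def)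
    show "fmap ?F X Y A \<in> Hom ?D (fobj ?F X) (fobj ?F Y)"
      if "X \<in> Obj ?C" "Y \<in> Obj ?C" "A \<in> Hom ?C X Y"
      using precompose_linear[OF perm_rep_module ract[OF that(2)] _ perm_map_rep_hom[OF that], of R]
        perm_hom_space_vectorspace[OF R that(1)]
      by (simp add: ktilde_obj_simps vectorspace_def) (simp add: Vect_def)
    show "fmap ?F X X (Ident ?C X) = Ident ?D (fobj ?F X)" if "X \<in> Obj ?C"
    proof -
      have "compose (carrier (space (perm_rep K G X))) f (\<lambda>a \<in> carrier (space (perm_rep K G X)). a) = f"
        if "f \<in> rep_hom K G (perm_rep K G X) R" for f
        by (rule compose_Id[OF _ linear_maps_extensional[OF rep_hom_linear[OF that]]])
          (auto intro: rep_hom_closed[OF that])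
      then show ?thesis
        unfolding ktilde_obj_simps perm_map_Ident[OF that]
        by (auto simp: Vect_def hom_space_simps intro!: restrict_ext)
    qed
    show "fmap ?F X Z (Cmp ?C X Y Z B A)
        = Cmp ?D (fobj ?F X) (fobj ?F Y) (fobj ?F Z) (fmap ?F Y Z B) (fmap ?F X Y A)"
      if "X \<in> Obj ?C" "Y \<in> Obj ?C" "Z \<in> Obj ?C" "A \<in> Hom ?C X Y" "B \<in> Hom ?C Y Z"
      unfolding ktilde_obj_simps perm_map_Cmp[OF that]
      by (auto simp: Vect_def hom_space_simps compose_def[of "rep_hom K G _ _"]
          comp[OF that(1,2,4)] rep_hom_compose_assoc[OF perm_map_rep_hom[OF that(2,3,5)]]
          intro!: restrict_ext)
    show "fmap ?F X Y (Add ?C X Y A B) = Add ?D (fobj ?F X) (fobj ?F Y) (fmap ?F X Y A) (fmap ?F X Y B)"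
      if "X \<in> Obj ?C" "Y \<in> Obj ?C" "A \<in> Hom ?C X Y" "B \<in> Hom ?C X Y"
      unfolding ktilde_obj_simps perm_map_Add[OF that]
      by (auto simp: Vect_def hom_space_simps compose_def linear_maps_add[OF rep_hom_linear]
          rep_hom_closed[OF perm_map_rep_hom[OF that(1-3)]]
          rep_hom_closed[OF perm_map_rep_hom[OF that(1,2,4)]] intro!: restrict_ext)
    show "fmap ?F X Y (Null ?C X Y) = Null ?D (fobj ?F X) (fobj ?F Y)"
      if "X \<in> Obj ?C" "Y \<in> Obj ?C"
      unfolding ktilde_obj_simps perm_map_Null[OF that]
      by (auto simp: Vect_def hom_space_simps compose_def
          linear_maps_zero[OF perm_rep_module representation_module[OF R] rep_hom_linear]
          intro!: restrict_ext)
  qed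
qed

text \<open>Postcomposition with \<open>f\<close> commutes with precomposition by the map of a span,
  so naturality of the components is associativity of composition.\<close>

lemma cat_functor_ktilde:
  "cat_functor (Rep K G :: (('c, 'a, 'v) rep, 'v \<Rightarrow> 'v) cat)
    (Mky K G :: (('c, 'a, 'x, ('x \<Rightarrow> 'a) \<Rightarrow> 'v) mackey,
                 ('c, 'x) gset \<Rightarrow> (('x \<Rightarrow> 'a) \<Rightarrow> 'v) \<Rightarrow> ('x \<Rightarrow> 'a) \<Rightarrow> 'v) cat)
    (ktilde K G)" (is "cat_functor ?C ?D ?F")
proof -
  interpret C: category ?C by (rule category_Rep)
  interpret D: category ?D by (rule category_Mky)
  have ract: "ract (perm_rep K G X) g a \<in> carrier (space (perm_rep K G X))"
    if "X \<in> Obj (Spn G)" "g \<in> carrier G" "a \<in> carrier (space (perm_rep K G X))" for X :: "('c, 'x) gset" and g a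
    using perm_rep_ract_closed that by (simp add: Obj_Spn)
  have comp: "compose (carrier (space (perm_rep K G X))) f e \<in> rep_hom K G (perm_rep K G X) R"
    if "X \<in> Obj (Spn G)" "f \<in> rep_hom K G Q R" "e \<in> rep_hom K G (perm_rep K G X) Q"
    for X :: "('c, 'x) gset" and Q R :: "('c, 'a, 'v) rep" and e f
    by (rule rep_hom_compose[OF perm_rep_module ract[OF that(1)] that(3,2)])
  show ?thesis
  proof
    fix P Q R :: "('c, 'a, 'v) rep" and e f
    show "Q \<in> Obj ?C \<Longrightarrow> fobj ?F Q \<in> Obj ?D"
      using additive_functor_ktilde_obj by (simp add: ktilde_simps Rep_def Mky_def)
    show "fmap ?F Q R f \<in> Hom ?D (fobj ?F Q) (fobj ?F R)"
      if Q: "Q \<in> Obj ?C" and R: "R \<in> Obj ?C" and f: "f \<in> Hom ?C Q R"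
    proof -
      have QR: "representation K G Q" "representation K G R" "f \<in> rep_hom K G Q R"
        using Q R f by (simp_all add: Rep_def)
      have "fmap ?F Q R f \<in> nat_trans (Spn G) (Vect K) (ktilde_obj K G Q) (ktilde_obj K G R)"
      proof (rule nat_transI)
        fix X :: "('c, 'x) gset" assume X: "X \<in> Obj (Spn G)"
        then show "fmap ?F Q R f X \<in> Hom (Vect K) (fobj (ktilde_obj K G Q) X) (fobj (ktilde_obj K G R) X)"
          using postcompose_linear[OF perm_rep_module ract[OF X] _ QR(3)]
            perm_hom_space_vectorspace[OF QR(1) X]
          by (simp add: ktilde_simps ktilde_obj_simps vectorspace_def) (simp add: Vect_def)
      next
        fix X Y :: "('c, 'x) gset" and A
        assume X: "X \<in> Obj (Spn G)" and Y: "Y \<in> Obj (Spn G)" and A: "A \<in> Hom (Spn G) X Y"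
        note comp_A = rep_hom_compose[OF perm_rep_module ract[OF Y] perm_map_rep_hom[OF X Y A]]
        show "Cmp (Vect K) (fobj (ktilde_obj K G Q) X) (fobj (ktilde_obj K G R) X)
            (fobj (ktilde_obj K G R) Y) (fmap (ktilde_obj K G R) X Y A) (fmap ?F Q R f X)
          = Cmp (Vect K) (fobj (ktilde_obj K G Q) X) (fobj (ktilde_obj K G Q) Y)
            (fobj (ktilde_obj K G R) Y) (fmap ?F Q R f Y) (fmap (ktilde_obj K G Q) X Y A)"
          using X Y by (auto simp: Vect_def ktilde_simps ktilde_obj_simps hom_space_simps
              compose_def[of "rep_hom K G _ _"] comp[OF X QR(3)] comp_A
              rep_hom_compose_assoc[OF perm_map_rep_hom[OF X Y A]] intro!: restrict_ext)
      qed (simp add: ktilde_simps)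
      then show ?thesis by (simp add: ktilde_simps(1) Mky_def)
    qed
    show "fmap ?F Q Q (Ident ?C Q) = Ident ?D (fobj ?F Q)"
    proof -
      have "compose (carrier (space (perm_rep K G X))) (\<lambda>v \<in> carrier (space Q). v) e = e"
        if "e \<in> rep_hom K G (perm_rep K G X) Q" for X :: "('c, 'x) gset" and e
        using that by (intro extensionalityI[of _ "carrier (space (perm_rep K G X))"])
          (auto simp: compose_def rep_hom_closed dest: rep_hom_linear linear_maps_extensional)
      then show ?thesis
        by (auto simp: ktilde_simps ktilde_obj_simps Rep_def Mky_def Vect_def hom_space_simps
            intro!: restrict_ext)
    qed
    show "fmap ?F P R (Cmp ?C P Q R f e)
        = Cmp ?D (fobj ?F P) (fobj ?F Q) (fobj ?F R) (fmap ?F Q R f) (fmap ?F P Q e)"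
      if "e \<in> Hom ?C P Q"
    proof -
      have "e \<in> rep_hom K G P Q" using that by (simp add: Rep_def)
      then show ?thesis
        by (auto simp: ktilde_simps ktilde_obj_simps Rep_def Mky_def Vect_def hom_space_simps
            compose_def[of "rep_hom K G _ _"] comp rep_hom_compose_assoc intro!: restrict_ext)
    qed
  qed
qed

end

end

section \<open>Full faithfulness\<close>

text \<open>\<open>G\<close> with left translation, transported along an injection into
  \<open>'x\<close>; the base point is the image of the unit. The inverse \<open>c\<close> of the
  injection reads off the one group element that moves \<open>e\<close> to \<open>z\<close>.\<close>

lemma (in group) exists_free_gset:
  assumes fin: "finite (carrier G)" and inf: "infinite (UNIV :: 'x set)"
  obtains \<Gamma> :: "('a, 'x) gset" and e c where "finite_gset G \<Gamma>" and "e \<in> pts \<Gamma>" and "c e = \<one>"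
    and "\<And>z. z \<in> pts \<Gamma> \<Longrightarrow> c z \<in> carrier G" and "\<And>z. z \<in> pts \<Gamma> \<Longrightarrow> gact \<Gamma> (c z) e = z"
    and "\<And>g z. g \<in> carrier G \<Longrightarrow> z \<in> pts \<Gamma> \<Longrightarrow> c (gact \<Gamma> g z) = g \<otimes> c z"
proof -
  obtain h :: "'a \<Rightarrow> 'x" where h: "inj_on h (carrier G)"
    using exists_inj_on_infinite[OF inf fin] by blast
  let ?L = "\<lparr>pts = carrier G, gact = (\<lambda>g. \<lambda>x \<in> carrier G. g \<otimes> x)\<rparr>"
  have "finite_gset G ?L"
    using fin by (intro finite_gsetI) (auto simp: m_assoc)
  then have "finite_gset G (transport_gset h ?L)"
    using h by (intro transport_gset) simp_all
  then show thesis
    by (rule that[of _ "h \<one>" "inv_into (carrier G) h"])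
      (use h in \<open>auto simp: transport_gset_def\<close>)
qed

lemma representation_ract_closed:
  "representation K G R \<Longrightarrow> g \<in> carrier G \<Longrightarrow> v \<in> carrier (space R) \<Longrightarrow> ract R g v \<in> carrier (space R)"
  by (rule linear_maps_closed[OF representation_ract])

lemma representation_ract_one:
  "representation K G R \<Longrightarrow> v \<in> carrier (space R) \<Longrightarrow> ract R \<one>\<^bsub>G\<^esub> v = v"
  by (metis representation_def group_action.id_eq_one restrict_apply')

lemma representation_ract_mult:
  assumes "representation K G R" "g \<in> carrier G" "h \<in> carrier G" "v \<in> carrier (space R)"
  shows "ract R (g \<otimes>\<^bsub>G\<^esub> h) v = ract R g (ract R h v)"
  using assms by (auto simp: representation_def intro: group_action.composition_rule)

section \<open>The universal property of permutation representations\<close>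

context perm_functor
begin

lemma basis_vec_carrier: "basis_vec K X x \<in> carrier (space (perm_rep K G X))"
  by (simp add: perm_rep_simps func_space_simps basis_vec_closed)

lemma ract_basis_vec:
  assumes X: "finite_gset G X" and g: "g \<in> carrier G" and x: "x \<in> pts X"
  shows "ract (perm_rep K G X) g (basis_vec K X x) = basis_vec K X (gact X g x)"
proof -
  have "gact X (inv\<^bsub>G\<^esub> g) y = x \<longleftrightarrow> y = gact X g x" if "y \<in> pts X" for y
    using that X g x by auto
  then show ?thesis
    using X g by (auto simp: perm_rep_simps basis_vec_closed) (auto simp: basis_vec_def)
qed

text \<open>On a finite set a function is the combination of the indicators of points with its
  values as coefficients; \<open>f\<close> is then applied term by term.\<close>

lemma linear_maps_perm_expand:
  assumes V: "module K V" and f: "f \<in> linear_maps K (space (perm_rep K G X)) V"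
    and X: "finite_gset G X" and a: "a \<in> perm_space X"
  shows "f a = (\<Oplus>\<^bsub>V\<^esub>x\<in>pts X. a x \<odot>\<^bsub>V\<^esub> f (basis_vec K X x))"
proof -
  let ?F = "func_space (pts X)"
  interpret F: module K ?F by (rule func_space_is_module)
  interpret V: module K V by (rule V)
  have f': "f \<in> linear_maps K ?F V" using f by (simp add: perm_rep_simps)
  have basis: "basis_vec K X x \<in> carrier ?F" for x
    using basis_vec_closed by (simp add: func_space_simps)
  have fb: "f (basis_vec K X x) \<in> carrier V" for x
    by (rule linear_maps_closed[OF f' basis])
  have ax: "x \<in> pts X \<Longrightarrow> a x \<in> carrier K" for x using a by auto
  have "a = (\<Oplus>\<^bsub>?F\<^esub>x\<in>pts X. a x \<odot>\<^bsub>?F\<^esub> basis_vec K X x)" (is "_ = ?s")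
  proof (rule extensionalityI[of _ "pts X"])
    have "?s \<in> carrier ?F" using ax basis by (intro F.finsum_closed Pi_I F.smult_closed)
    then show "?s \<in> extensional (pts X)" by (simp add: func_space_simps PiE_def)
    fix y assume y: "y \<in> pts X"
    have "?s y = (\<Oplus>x\<in>pts X. (a x \<odot>\<^bsub>?F\<^esub> basis_vec K X x) y)"
      using ax basis y G.finite_pts[OF X] by (intro finsum_func_space F.smult_closed)
    also have "\<dots> = (\<Oplus>x\<in>pts X. if y = x then a x else \<zero>)"
      using ax y by (intro finsum_cong') (auto simp: func_space_simps basis_vec_def)
    also have "\<dots> = a y"
      using ax y G.finite_pts[OF X] by (intro finsum_singleton) auto
    finally show "a y = ?s y" ..
  qed (use a in \<open>simp add: PiE_def\<close>)
  then have "f a = f ?s" by simp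
  also have "\<dots> = (\<Oplus>\<^bsub>V\<^esub>x\<in>pts X. f (a x \<odot>\<^bsub>?F\<^esub> basis_vec K X x))"
    using ax basis G.finite_pts[OF X]
    by (intro linear_maps_finsum[OF F.module_axioms V f'] F.smult_closed)
  also have "\<dots> = (\<Oplus>\<^bsub>V\<^esub>x\<in>pts X. a x \<odot>\<^bsub>V\<^esub> f (basis_vec K X x))"
    using ax fb by (intro V.finsum_cong') (auto simp: linear_maps_smult[OF f' _ basis])
  finally show ?thesis .
qed

lemma perm_rep_hom_eqI:
  assumes R: "representation K G R" and X: "finite_gset G X"
    and f: "f \<in> rep_hom K G (perm_rep K G X) R" and f': "f' \<in> rep_hom K G (perm_rep K G X) R"
    and "\<And>x. x \<in> pts X \<Longrightarrow> f (basis_vec K X x) = f' (basis_vec K X x)"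
  shows "f = f'"
proof (rule rep_hom_eqI[OF f f'])
  interpret R: module K "space R" by (rule representation_module[OF R])
  fix a assume "a \<in> carrier (space (perm_rep K G X))"
  then have a: "a \<in> perm_space X" by (simp add: perm_rep_simps func_space_simps)
  show "f a = f' a"
    unfolding linear_maps_perm_expand[OF R.module_axioms rep_hom_linear[OF f] X a]
      linear_maps_perm_expand[OF R.module_axioms rep_hom_linear[OF f'] X a]
    using a by (intro R.finsum_cong')
      (auto simp: assms(5) intro!: R.smult_closed rep_hom_closed[OF f'] basis_vec_carrier)
qed

text \<open>Existence in the universal property of \<open>kX\<close>; uniqueness is
  \<open>perm_rep_hom_eqI\<close>. The witness extends \<tau> linearly from the basis of
  points.\<close>

lemma equivariant_extends_to_perm_rep:
  assumes R: "representation K G R" and X: "finite_gset G X"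
    and \<tau>: "\<And>x. x \<in> pts X \<Longrightarrow> \<tau> x \<in> carrier (space R)"
    and equiv: "\<And>g x. g \<in> carrier G \<Longrightarrow> x \<in> pts X \<Longrightarrow> \<tau> (gact X g x) = ract R g (\<tau> x)"
  shows "\<exists>f \<in> rep_hom K G (perm_rep K G X) R. \<forall>x \<in> pts X. f (basis_vec K X x) = \<tau> x"
proof (intro bexI ballI)
  interpret R: module K "space R" by (rule representation_module[OF R])
  let ?f = "\<lambda>a \<in> perm_space X. \<Oplus>\<^bsub>space R\<^esub>x\<in>pts X. a x \<odot>\<^bsub>space R\<^esub> \<tau> x"
  note fin = G.finite_pts[OF X]
  have term_closed: "a x \<odot>\<^bsub>space R\<^esub> \<tau> x \<in> carrier (space R)" if "a \<in> perm_space X" "x \<in> pts X" for a x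
    using that \<tau> by auto
  show "?f \<in> rep_hom K G (perm_rep K G X) R"
  proof (intro rep_homI linear_mapsI; unfold perm_rep_simps(1) func_space_simps(1))
    show "?f a \<in> carrier (space R)" if "a \<in> perm_space X" for a
      using that term_closed by (auto intro!: R.finsum_closed)
    show "?f (a \<oplus>\<^bsub>func_space (pts X)\<^esub> b) = ?f a \<oplus>\<^bsub>space R\<^esub> ?f b"
      if a: "a \<in> perm_space X" and b: "b \<in> perm_space X" for a b
    proof -
      have "a \<oplus>\<^bsub>func_space (pts X)\<^esub> b \<in> perm_space X"
        using a b by (auto simp: func_space_simps)
      then have "?f (a \<oplus>\<^bsub>func_space (pts X)\<^esub> b)
        = (\<Oplus>\<^bsub>space R\<^esub>x\<in>pts X. (a \<oplus>\<^bsub>func_space (pts X)\<^esub> b) x \<odot>\<^bsub>space R\<^esub> \<tau> x)"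
        by simp
      also have "\<dots> = (\<Oplus>\<^bsub>space R\<^esub>x\<in>pts X. a x \<odot>\<^bsub>space R\<^esub> \<tau> x \<oplus>\<^bsub>space R\<^esub> b x \<odot>\<^bsub>space R\<^esub> \<tau> x)"
        using term_closed[OF a] term_closed[OF b] \<tau>
        by (intro R.finsum_cong') (auto simp: func_space_simps R.smult_l_distr
            PiE_mem[OF a] PiE_mem[OF b])
      also have "\<dots> = ?f a \<oplus>\<^bsub>space R\<^esub> ?f b"
        using term_closed[OF a] term_closed[OF b] a b by (simp add: R.finsum_addf)
      finally show ?thesis .
    qed
    show "?f (k \<odot>\<^bsub>func_space (pts X)\<^esub> a) = k \<odot>\<^bsub>space R\<^esub> ?f a"
      if k: "k \<in> carrier K" and a: "a \<in> perm_space X" for k a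
    proof -
      have "k \<odot>\<^bsub>func_space (pts X)\<^esub> a \<in> perm_space X"
        using k a by (auto simp: func_space_simps)
      then have "?f (k \<odot>\<^bsub>func_space (pts X)\<^esub> a)
        = (\<Oplus>\<^bsub>space R\<^esub>x\<in>pts X. k \<odot>\<^bsub>space R\<^esub> (a x \<odot>\<^bsub>space R\<^esub> \<tau> x))"
        using term_closed[OF a] k \<tau>
        by (auto intro!: R.finsum_cong' simp: func_space_simps R.smult_assoc1[symmetric]
            PiE_mem[OF a])
      also have "\<dots> = k \<odot>\<^bsub>space R\<^esub> ?f a"
        using term_closed[OF a] a k by (simp add: R.finsum_smult)
      finally show ?thesis .
    qed
    show "?f (ract (perm_rep K G X) g a) = ract R g (?f a)"
      if g: "g \<in> carrier G" and a: "a \<in> perm_space X" for g a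
    proof -
      have ga: "ract (perm_rep K G X) g a \<in> perm_space X"
        using perm_rep_ract_closed[OF X g, of a] a by (simp add: perm_rep_simps(1) func_space_simps)
      have bij: "bij_betw (gact X g) (pts X) (pts X)"
        using X g by (intro bij_betw_byWitness[where f' = "gact X (inv\<^bsub>G\<^esub> g)"]) auto
      \<comment> \<open>The sum is reindexed by the action of \<open>g\<close>: at the translate of
        \<open>x\<close> the translated function has the value \<open>a x\<close>, and \<tau> there
        is \<open>g\<close> applied to \<open>\<tau> x\<close>.\<close>
      have "?f (ract (perm_rep K G X) g a)
        = (\<Oplus>\<^bsub>space R\<^esub>x\<in>pts X. ract (perm_rep K G X) g a (gact X g x) \<odot>\<^bsub>space R\<^esub> \<tau> (gact X g x))"
        using ga term_closed[OF ga]
        by (simp only: restrict_apply' if_True) (rule R.finsum_reindex_bij_betw[OF bij, symmetric])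
      also have "\<dots> = (\<Oplus>\<^bsub>space R\<^esub>x\<in>pts X. ract R g (a x \<odot>\<^bsub>space R\<^esub> \<tau> x))"
        using X g \<tau> term_closed[OF a] representation_ract_closed[OF R g]
        by (intro R.finsum_cong')
          (auto simp: perm_rep_simps(2)[OF a] equiv PiE_mem[OF a]
            linear_maps_smult[OF representation_ract[OF R g]])
      also have "\<dots> = ract R g (?f a)"
        using a fin term_closed[OF a]
        by (simp add: linear_maps_finsum[OF R.module_axioms R.module_axioms
              representation_ract[OF R g]])
      finally show ?thesis .
    qed
  qed simp
  fix x assume x: "x \<in> pts X"
  have "(\<Oplus>\<^bsub>space R\<^esub>y\<in>pts X. basis_vec K X x y \<odot>\<^bsub>space R\<^esub> \<tau> y)
    = (\<Oplus>\<^bsub>space R\<^esub>y\<in>pts X. if x = y then \<tau> y else \<zero>\<^bsub>space R\<^esub>)"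
    using \<tau> by (intro R.finsum_cong') (auto simp: basis_vec_def)
  also have "\<dots> = \<tau> x" using \<tau> fin x by (intro R.finsum_singleton) auto
  finally show "?f (basis_vec K X x) = \<tau> x" by (simp add: basis_vec_closed)
qed

end

text \<open>
  \<open>\<Gamma>\<close> is a copy of \<open>G\<close> under left translation, with base point \<open>e\<close>; every point \<open>z\<close> is
  \<open>c z\<close> applied to \<open>e\<close>.
\<close>

locale free_perm_functor = perm_functor K G for K :: "('k, 'm) ring_scheme" (structure)
    and G :: "('g, 'n) monoid_scheme" +
  fixes \<Gamma> :: "('g, 'x) gset" and e :: 'x and c :: "'x \<Rightarrow> 'g"
  assumes inf: "infinite (UNIV :: 'x set)"
    and \<Gamma>: "finite_gset G \<Gamma>" and e: "e \<in> pts \<Gamma>" and c_e: "c e = \<one>\<^bsub>G\<^esub>"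
    and c_closed: "z \<in> pts \<Gamma> \<Longrightarrow> c z \<in> carrier G"
    and c_act: "z \<in> pts \<Gamma> \<Longrightarrow> gact \<Gamma> (c z) e = z"
    and c_mult: "g \<in> carrier G \<Longrightarrow> z \<in> pts \<Gamma> \<Longrightarrow> c (gact \<Gamma> g z) = g \<otimes>\<^bsub>G\<^esub> c z"
begin

text \<open>The basis vector at \<open>e\<close> generates the representation, every other one being
  its translate by \<open>c z\<close>.\<close>

lemma free_rep_hom_eqI:
  assumes R: "representation K G R"
    and f: "f \<in> rep_hom K G (perm_rep K G \<Gamma>) R" and f': "f' \<in> rep_hom K G (perm_rep K G \<Gamma>) R"
    and eq: "f (basis_vec K \<Gamma> e) = f' (basis_vec K \<Gamma> e)"
  shows "f = f'"
proof (rule perm_rep_hom_eqI[OF R \<Gamma> f f'])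
  fix z assume z: "z \<in> pts \<Gamma>"
  have "basis_vec K \<Gamma> z = ract (perm_rep K G \<Gamma>) (c z) (basis_vec K \<Gamma> e)"
    by (simp add: ract_basis_vec[OF \<Gamma> c_closed[OF z] e] c_act[OF z])
  then show "f (basis_vec K \<Gamma> z) = f' (basis_vec K \<Gamma> z)"
    by (simp add: rep_hom_equivariant[OF f] rep_hom_equivariant[OF f'] c_closed[OF z]
        basis_vec_carrier eq)
qed

text \<open>Equivariance forces the value \<open>c z\<close> applied to \<open>v\<close> at the
  point \<open>z\<close>. This assignment is equivariant by \<open>c_mult\<close>, and it gives
  \<open>v\<close> at \<open>e\<close> because \<open>c e\<close> is the unit.\<close>

lemma free_rep_hom_exists:
  assumes R: "representation K G R" and v: "v \<in> carrier (space R)"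
  shows "\<exists>f \<in> rep_hom K G (perm_rep K G \<Gamma>) R. f (basis_vec K \<Gamma> e) = v"
proof -
  have "\<exists>f \<in> rep_hom K G (perm_rep K G \<Gamma>) R. \<forall>z \<in> pts \<Gamma>. f (basis_vec K \<Gamma> z) = ract R (c z) v"
    by (rule equivariant_extends_to_perm_rep[OF R \<Gamma>])
      (simp_all add: c_closed c_mult representation_ract_closed[OF R _ v]
        representation_ract_mult[OF R _ _ v])
  then obtain f where "f \<in> rep_hom K G (perm_rep K G \<Gamma>) R"
    and "\<And>z. z \<in> pts \<Gamma> \<Longrightarrow> f (basis_vec K \<Gamma> z) = ract R (c z) v"
    by blast
  moreover from this(2)[OF e] have "f (basis_vec K \<Gamma> e) = v"
    by (simp add: c_e representation_ract_one[OF R v])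
  ultimately show ?thesis by blast
qed

definition orbit_span :: "('g, 'x) gset \<Rightarrow> 'x \<Rightarrow> ('g, 'x, 'x) gspan" where
  "orbit_span X x
    = \<lparr>lleg = (\<lambda>z \<in> pts \<Gamma>. gact X (c z) x), apex = \<Gamma>, rleg = (\<lambda>z \<in> pts \<Gamma>. z)\<rparr>"

lemma orbit_span_in_spans:
  assumes "finite_gset G X" "x \<in> pts X"
  shows "orbit_span X x \<in> spans G X \<Gamma>"
  using assms \<Gamma> unfolding spans_def orbit_span_def
  by (auto intro!: G.gmapsI simp: c_closed c_mult G.gact_mult)

text \<open>The right leg is the identity, so in the sum for the coordinate \<open>y\<close> only
  \<open>z = e\<close> can contribute. As \<open>c e\<close> is the unit, \<open>e\<close> lies over
  \<open>x\<close> under the left leg, hence it contributes exactly for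
  \<open>y = x\<close>.\<close>

lemma perm_span_map_orbit_span:
  assumes X: "finite_gset G X" and x: "x \<in> pts X"
  shows "perm_span_map K X \<Gamma> (orbit_span X x) (basis_vec K \<Gamma> e) = basis_vec K X x"
proof (rule extensionalityI[of _ "pts X"])
  note S = orbit_span_in_spans[OF X x]
  show "perm_span_map K X \<Gamma> (orbit_span X x) (basis_vec K \<Gamma> e) \<in> extensional (pts X)"
    using perm_span_map_closed[OF S X \<Gamma> basis_vec_closed] by (simp add: PiE_def)
  fix y assume y: "y \<in> pts X"
  let ?A = "{z \<in> pts \<Gamma>. gact X (c z) x = y}"
  have "perm_span_map K X \<Gamma> (orbit_span X x) (basis_vec K \<Gamma> e) y
    = (\<Oplus>z\<in>{z \<in> pts (apex (orbit_span X x)). lleg (orbit_span X x) z = y}.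
        basis_vec K \<Gamma> e (rleg (orbit_span X x) z))"
    by (rule perm_span_map_apply[OF S X \<Gamma> basis_vec_closed y])
  also have "\<dots> = (\<Oplus>z\<in>?A. if e = z then \<one> else \<zero>)"
    by (rule finsum_cong') (auto simp: orbit_span_def basis_vec_def)
  also have "\<dots> = (if e \<in> ?A then \<one> else \<zero>)"
  proof (cases "e \<in> ?A")
    case True
    then show ?thesis
      using finsum_singleton[OF True, of "\<lambda>_. \<one>"] G.finite_pts[OF \<Gamma>] by simp
  next
    case False
    then have "(\<Oplus>z\<in>?A. if e = z then \<one> else \<zero>) = (\<Oplus>z\<in>?A. \<zero>)"
      by (intro finsum_cong') auto
    then show ?thesis using False by simp
  qed
  also have "\<dots> = basis_vec K X x y"
    using X x y e by (auto simp: c_e basis_vec_def)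
  finally show "perm_span_map K X \<Gamma> (orbit_span X x) (basis_vec K \<Gamma> e) y = basis_vec K X x y" .
qed (simp add: basis_vec_def)

section \<open>Reconstruction of \<open>f\<close> from \<theta> for fixed \<open>Q\<close> and
  \<open>R\<close>\<close>

context
  fixes Q R :: "('g, 'k, 'v) rep"
  assumes Q: "representation K G Q" and R: "representation K G R"
begin

text \<open>The inverse of evaluation at \<open>e\<close>. The chosen map is unique by
  \<open>free_rep_hom_eqI\<close>, so the choice carries no arbitrariness.\<close>

definition free_hom :: "'v \<Rightarrow> ('x \<Rightarrow> 'k) \<Rightarrow> 'v" where
  "free_hom v = (SOME f. f \<in> rep_hom K G (perm_rep K G \<Gamma>) Q \<and> f (basis_vec K \<Gamma> e) = v)"

lemma free_hom:
  assumes "v \<in> carrier (space Q)"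
  shows "free_hom v \<in> rep_hom K G (perm_rep K G \<Gamma>) Q" "free_hom v (basis_vec K \<Gamma> e) = v"
  using someI_ex[OF free_rep_hom_exists[OF Q assms, unfolded Bex_def]]
  unfolding free_hom_def[symmetric] by auto

text \<open>Used to identify \<open>free_hom\<close> at a sum, at a multiple and at a value of a
  composite: a homomorphism with the right value at \<open>e\<close> is the one that
  \<open>free_hom\<close> returns.\<close>

lemma free_hom_eqI:
  assumes "f \<in> rep_hom K G (perm_rep K G \<Gamma>) Q"
  shows "free_hom (f (basis_vec K \<Gamma> e)) = f"
  using free_hom[OF rep_hom_closed[OF assms basis_vec_carrier]] free_rep_hom_eqI[OF Q _ assms]
  by simp

text \<open>Naturality along the orbit span of \<open>x\<close> equates
  \<open>\<theta> X \<psi>\<close> composed with the induced map and \<theta> at \<Gamma> applied to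
  \<psi> composed with it. At \<open>e\<close> the former gives the value of
  \<open>\<theta> X \<psi>\<close> at \<open>x\<close>; the composite with \<psi> has the value of
  \<psi> at \<open>x\<close>, which identifies it as a \<open>free_hom\<close>.\<close>

lemma nat_trans_eval:
  assumes \<theta>: "\<theta> \<in> nat_trans (Spn G) (Vect K) (ktilde_obj K G Q) (ktilde_obj K G R)"
    and X: "finite_gset G X" and \<psi>: "\<psi> \<in> rep_hom K G (perm_rep K G X) Q" and x: "x \<in> pts X"
  shows "\<theta> X \<psi> (basis_vec K X x) = \<theta> \<Gamma> (free_hom (\<psi> (basis_vec K X x))) (basis_vec K \<Gamma> e)"
proof -
  let ?S = "span_class G X \<Gamma> (orbit_span X x)" and ?k\<Gamma> = "carrier (space (perm_rep K G \<Gamma>))"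
  let ?m = "perm_map K X \<Gamma> ?S"
  note objs = X[folded Obj_Spn] \<Gamma>[folded Obj_Spn]
  note S = orbit_span_in_spans[OF X x]
  have hom: "?S \<in> Hom (Spn G) X \<Gamma>" by (rule G.span_class_in_Hom[OF inf S])
  have m: "?m \<in> rep_hom K G (perm_rep K G \<Gamma>) (perm_rep K G X)"
    by (rule perm_map_rep_hom[OF inf objs hom])
  have m_e: "?m (basis_vec K \<Gamma> e) = basis_vec K X x"
    by (simp add: perm_map_span_class[OF inf S X \<Gamma>] perm_span_map_orbit_span[OF X x])
  have comp: "compose ?k\<Gamma> \<psi> ?m \<in> rep_hom K G (perm_rep K G \<Gamma>) Q"
    by (rule rep_hom_compose[OF perm_rep_module perm_rep_ract_closed[OF \<Gamma>] m \<psi>])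
  have "compose ?k\<Gamma> \<psi> ?m (basis_vec K \<Gamma> e) = \<psi> (basis_vec K X x)"
    by (simp add: compose_def basis_vec_carrier m_e)
  then have free: "compose ?k\<Gamma> \<psi> ?m = free_hom (\<psi> (basis_vec K X x))"
    using free_hom_eqI[OF comp] by simp
  have \<theta>X: "\<theta> X \<psi> \<in> rep_hom K G (perm_rep K G X) R"
    using nat_trans_in[OF \<theta> objs(1)] \<psi> unfolding ktilde_obj_simps
    by (auto simp: Vect_def hom_space_simps dest: linear_maps_closed)
  have "compose ?k\<Gamma> (\<theta> X \<psi>) ?m = \<theta> \<Gamma> (compose ?k\<Gamma> \<psi> ?m)"
    using fun_cong[OF nat_trans_natural[OF \<theta> objs hom], of \<psi>] \<psi> \<theta>X
    by (simp add: Vect_def ktilde_obj_simps hom_space_simps compose_def[of "rep_hom K G _ _"])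
  then have "compose ?k\<Gamma> (\<theta> X \<psi>) ?m (basis_vec K \<Gamma> e)
      = \<theta> \<Gamma> (free_hom (\<psi> (basis_vec K X x))) (basis_vec K \<Gamma> e)"
    by (simp add: free)
  then show ?thesis by (simp add: compose_def basis_vec_carrier m_e)
qed

lemma ktilde_full:
  fixes \<theta> :: "('g, 'x) gset \<Rightarrow> (('x \<Rightarrow> 'k) \<Rightarrow> 'v) \<Rightarrow> ('x \<Rightarrow> 'k) \<Rightarrow> 'v"
  assumes \<theta>: "\<theta> \<in> nat_trans (Spn G) (Vect K) (ktilde_obj K G Q) (ktilde_obj K G R)"
  shows "\<exists>f \<in> rep_hom K G Q R. fmap (ktilde K G) Q R f = \<theta>"
proof
  let ?k\<Gamma> = "perm_rep K G \<Gamma>" and ?\<delta> = "basis_vec K \<Gamma> e"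
  let ?f = "\<lambda>v \<in> carrier (space Q). \<theta> \<Gamma> (free_hom v) ?\<delta>"
  interpret Q: module K "space Q" by (rule representation_module[OF Q])
  interpret H: module K "hom_space K G ?k\<Gamma> Q"
    using perm_hom_space_vectorspace[OF Q \<Gamma>[folded Obj_Spn]] by (simp add: vectorspace_def)
  have lin: "\<theta> X \<in> linear_maps K (hom_space K G (perm_rep K G X) Q) (hom_space K G (perm_rep K G X) R)"
    if "finite_gset G X" for X
    using nat_trans_in[OF \<theta> that[folded Obj_Spn]] by (simp add: ktilde_obj_simps Vect_def)
  have \<theta>_hom: "\<theta> X \<psi> \<in> rep_hom K G (perm_rep K G X) R"
    if "finite_gset G X" "\<psi> \<in> rep_hom K G (perm_rep K G X) Q" for X \<psi>
    using linear_maps_closed[OF lin[OF that(1)]] that(2) by (simp add: hom_space_simps)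
  have eval: "\<theta> X \<psi> (basis_vec K X x) = ?f (\<psi> (basis_vec K X x))"
    if "finite_gset G X" "\<psi> \<in> rep_hom K G (perm_rep K G X) Q" "x \<in> pts X" for X \<psi> x
    using nat_trans_eval[OF \<theta> that] rep_hom_closed[OF that(2) basis_vec_carrier] by simp
  show f: "?f \<in> rep_hom K G Q R"
  proof (intro rep_homI linear_mapsI)
    show "?f v \<in> carrier (space R)" if "v \<in> carrier (space Q)" for v
      using rep_hom_closed[OF \<theta>_hom[OF \<Gamma> free_hom(1)[OF that]] basis_vec_carrier] that by simp
    show "?f (v \<oplus>\<^bsub>space Q\<^esub> w) = ?f v \<oplus>\<^bsub>space R\<^esub> ?f w"
      if v: "v \<in> carrier (space Q)" and w: "w \<in> carrier (space Q)" for v w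
    proof -
      have vw: "free_hom v \<in> carrier (hom_space K G ?k\<Gamma> Q)" "free_hom w \<in> carrier (hom_space K G ?k\<Gamma> Q)"
        using free_hom(1)[OF v] free_hom(1)[OF w] by (simp_all add: hom_space_simps)
      \<comment> \<open>The sum of the two homomorphisms has value \<open>v\<close> plus
        \<open>w\<close> at \<open>e\<close>, so it is the \<open>free_hom\<close> of that sum;
        additivity of \<open>f\<close> then follows from that of \<theta> at \<Gamma>.\<close>
      have "free_hom v \<oplus>\<^bsub>hom_space K G ?k\<Gamma> Q\<^esub> free_hom w \<in> rep_hom K G ?k\<Gamma> Q"
        using H.a_closed[OF vw] by (simp add: hom_space_simps(1))
      from free_hom_eqI[OF this]
      have "free_hom (v \<oplus>\<^bsub>space Q\<^esub> w) = free_hom v \<oplus>\<^bsub>hom_space K G ?k\<Gamma> Q\<^esub> free_hom w"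
        by (simp add: hom_space_simps(2) basis_vec_carrier free_hom(2)[OF v] free_hom(2)[OF w])
      then have "\<theta> \<Gamma> (free_hom (v \<oplus>\<^bsub>space Q\<^esub> w)) ?\<delta>
        = \<theta> \<Gamma> (free_hom v) ?\<delta> \<oplus>\<^bsub>space R\<^esub> \<theta> \<Gamma> (free_hom w) ?\<delta>"
        by (simp add: linear_maps_add[OF lin[OF \<Gamma>] vw] hom_space_simps(2)[where R = R] basis_vec_carrier)
      then show ?thesis using v w by simp
    qed
    show "?f (k \<odot>\<^bsub>space Q\<^esub> v) = k \<odot>\<^bsub>space R\<^esub> ?f v"
      if k: "k \<in> carrier K" and v: "v \<in> carrier (space Q)" for k v
    proof -
      have v': "free_hom v \<in> carrier (hom_space K G ?k\<Gamma> Q)"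
        using free_hom(1)[OF v] by (simp add: hom_space_simps)
      have "k \<odot>\<^bsub>hom_space K G ?k\<Gamma> Q\<^esub> free_hom v \<in> rep_hom K G ?k\<Gamma> Q"
        using H.smult_closed[OF k v'] by (simp add: hom_space_simps(1))
      from free_hom_eqI[OF this]
      have "free_hom (k \<odot>\<^bsub>space Q\<^esub> v) = k \<odot>\<^bsub>hom_space K G ?k\<Gamma> Q\<^esub> free_hom v"
        by (simp add: hom_space_simps(3) basis_vec_carrier free_hom(2)[OF v])
      then have "\<theta> \<Gamma> (free_hom (k \<odot>\<^bsub>space Q\<^esub> v)) ?\<delta> = k \<odot>\<^bsub>space R\<^esub> \<theta> \<Gamma> (free_hom v) ?\<delta>"
        by (simp add: linear_maps_smult[OF lin[OF \<Gamma>] k v'] hom_space_simps(3)[where R = R] basis_vec_carrier)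
      then show ?thesis using k v by simp
    qed
    show "?f (ract Q g v) = ract R g (?f v)"
      if g: "g \<in> carrier G" and v: "v \<in> carrier (space Q)" for g v
    proof -
      note \<phi> = free_hom[OF v]
      \<comment> \<open>The translate of \<open>v\<close> is the value of \<open>free_hom v\<close>
        at the translate of \<open>e\<close>. Evaluation at that point of \<Gamma> turns the claim
        into equivariance of \<open>\<theta> \<Gamma> (free_hom v)\<close>.\<close>
      have "?f (ract Q g v) = ?f (free_hom v (basis_vec K \<Gamma> (gact \<Gamma> g e)))"
        using rep_hom_equivariant[OF \<phi>(1) g basis_vec_carrier, of e]
        by (simp add: ract_basis_vec[OF \<Gamma> g e] \<phi>(2))
      also have "\<dots> = \<theta> \<Gamma> (free_hom v) (basis_vec K \<Gamma> (gact \<Gamma> g e))"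
        using eval[OF \<Gamma> \<phi>(1), of "gact \<Gamma> g e"] \<Gamma> g e by simp
      also have "\<dots> = ract R g (\<theta> \<Gamma> (free_hom v) ?\<delta>)"
        using rep_hom_equivariant[OF \<theta>_hom[OF \<Gamma> \<phi>(1)] g basis_vec_carrier, of e]
        by (simp add: ract_basis_vec[OF \<Gamma> g e])
      finally show ?thesis using v by simp
    qed
  qed simp
  show "fmap (ktilde K G) Q R ?f = \<theta>"
  proof (rule extensionalityI[OF _ nat_trans_extensional[OF \<theta>]])
    fix X :: "('g, 'x) gset" assume obj: "X \<in> Obj (Spn G)"
    then have X: "finite_gset G X" by (simp add: Obj_Spn)
    \<comment> \<open>Both sides are homomorphisms out of \<open>kX\<close>, so they need only be
      compared on basis vectors, where \<open>eval\<close> applies.\<close>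
    have "compose (carrier (space (perm_rep K G X))) ?f \<psi> = \<theta> X \<psi>"
      if \<psi>: "\<psi> \<in> rep_hom K G (perm_rep K G X) Q" for \<psi>
    proof (rule perm_rep_hom_eqI[OF R X rep_hom_compose[OF perm_rep_module
            perm_rep_ract_closed[OF X] \<psi> f] \<theta>_hom[OF X \<psi>]])
      fix x assume "x \<in> pts X"
      from eval[OF X \<psi> this]
      show "compose (carrier (space (perm_rep K G X))) ?f \<psi> (basis_vec K X x)
          = \<theta> X \<psi> (basis_vec K X x)"
        by (simp only: compose_eq[OF basis_vec_carrier])
    qed
    then show "fmap (ktilde K G) Q R ?f X = \<theta> X"
      using obj linear_maps_extensional[OF lin[OF X]]
      by (intro extensionalityI[of _ "rep_hom K G (perm_rep K G X) Q"])
        (simp_all add: ktilde_simps hom_space_simps)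
  qed (simp add: ktilde_simps)
qed

text \<open>The component at \<Gamma> postcomposes \<open>free_hom v\<close> with \<open>f\<close>,
  and at \<open>e\<close> the result is \<open>f v\<close>. Every value of \<open>f\<close> can thus
  be read off from its image.\<close>

lemma ktilde_faithful:
  assumes f: "f \<in> rep_hom K G Q R" and f': "f' \<in> rep_hom K G Q R"
    and eq: "(fmap (ktilde K G) Q R f :: ('g, 'x) gset \<Rightarrow> _) = fmap (ktilde K G) Q R f'"
  shows "f = f'"
proof (rule rep_hom_eqI[OF f f'])
  fix v assume v: "v \<in> carrier (space Q)"
  have "fmap (ktilde K G) Q R h \<Gamma> (free_hom v) (basis_vec K \<Gamma> e) = h v" for h :: "'v \<Rightarrow> 'v"
    using \<Gamma> free_hom[OF v] by (simp add: ktilde_simps Obj_Spn compose_def basis_vec_carrier)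
  from this[of f] this[of f'] show "f v = f' v" by (simp add: eq)
qed

end

end

theorem proposition10p1:
  fixes K :: "('k, 'm) ring_scheme" and G :: "('g, 'n) monoid_scheme"
  assumes "field K" and "group G" and "finite (carrier G)"
    and "infinite (UNIV :: 'x set)"
  shows "fully_faithful
    (Rep K G :: (('g, 'k, 'v) rep, 'v \<Rightarrow> 'v) cat)
    (Mky K G :: (('g, 'k, 'x, ('x \<Rightarrow> 'k) \<Rightarrow> 'v) mackey,
                 ('g, 'x) gset \<Rightarrow> (('x \<Rightarrow> 'k) \<Rightarrow> 'v) \<Rightarrow> ('x \<Rightarrow> 'k) \<Rightarrow> 'v) cat)
    (ktilde K G)"
proof -
  interpret perm_functor K G
    using assms by (simp add: perm_functor_def)
  obtain \<Gamma> :: "('g, 'x) gset" and e c where "free_perm_functor K G \<Gamma> e c"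
    using G.exists_free_gset[OF assms(3,4)] assms(4)
    by (metis free_perm_functor.intro free_perm_functor_axioms.intro perm_functor_axioms)
  then interpret free_perm_functor K G \<Gamma> e c .
  show ?thesis
  proof (intro fully_faithful.intro fully_faithful_axioms.intro cat_functor_ktilde[OF assms(4)])
    fix Q R :: "('g, 'k, 'v) rep"
    assume "Q \<in> Obj (Rep K G)" and "R \<in> Obj (Rep K G)"
    then have QR: "representation K G Q" "representation K G R" by (simp_all add: Rep_def)
    show "bij_betw (fmap (ktilde K G) Q R) (Hom (Rep K G) Q R)
        (Hom (Mky K G :: (('g, 'k, 'x, ('x \<Rightarrow> 'k) \<Rightarrow> 'v) mackey,
              ('g, 'x) gset \<Rightarrow> (('x \<Rightarrow> 'k) \<Rightarrow> 'v) \<Rightarrow> ('x \<Rightarrow> 'k) \<Rightarrow> 'v) cat)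
          (fobj (ktilde K G) Q) (fobj (ktilde K G) R))" (is "bij_betw ?F ?A ?B")
    proof (rule bij_betw_imageI)
      show "inj_on ?F ?A"
        using ktilde_faithful[OF QR] by (auto simp: Rep_def intro!: inj_onI)
      have "?F f \<in> ?B" if "f \<in> ?A" for f
        using cat_functor.fmap_in[OF cat_functor_ktilde[OF assms(4)]
            \<open>Q \<in> Obj (Rep K G)\<close> \<open>R \<in> Obj (Rep K G)\<close> that] .
      moreover have "\<theta> \<in> ?F ` ?A" if "\<theta> \<in> ?B" for \<theta>
      proof -
        have "\<theta> \<in> nat_trans (Spn G) (Vect K) (ktilde_obj K G Q) (ktilde_obj K G R)"
          using that by (simp add: Mky_def ktilde_simps(1))
        from ktilde_full[OF QR this] show ?thesis by (auto simp: Rep_def)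
      qed
      ultimately show "?F ` ?A = ?B" by blast
    qed
  qed
qed

end
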